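(* For every $\epsilon>0$ there is a constant $K(\epsilon)>0$, depending only on $\epsilon$, with the following property. Suppose that for some parameters $A,B,C\in\mathbb{C}$ there is a point $p\in\mathbb{C}^3$ such that for any two vertices $v_i\neq v_j$ in $\mathcal{V}_\infty=\{v_1,v_2,v_3\}$ there is a hyperbolic element $\gamma_{i,j}\in\mathcal{G}_{A,B,C}$ satisfying: (A) ${\rm Ind}(\gamma_{i,j})=v_i$ and ${\rm Attr}(\gamma_{i,j})=v_j$, and (B) $\sup_{z\in B_\epsilon(p)}\|\gamma_{i,j}(z)-z\|<K(\epsilon)$. Then, for any $D\in\mathbb{C}$, the set $B_{\epsilon/2}(p)\cap S_{A,B,C,D}$ is disjoint from any unbounded Fatou component of $\mathcal{G}_{A,B,C,D}$.
   Context: For $(A,B,C,D)\in\mathbb{C}^4$ let $S_{A,B,C,D}=\{(x,y,z)\in\mathbb{C}^3: x^2+y^2+z^2+xyz=Ax+By+Cz+D\}$. Let $s_x(x,y,z)=(-x-yz+A,\,y,\,z)$, $s_y(x,y,z)=(x,\,-y-xz+B,\,z)$, $s_z(x,y,z)=(x,\,y,\,-z-xy+C)$, which are polynomial automorphisms of $\mathbb{C}^3$ preserving every $S_{A,B,C,D}$, $D\in\mathbb{C}$. Let $\mathcal{G}^{\pm}_{A,B,C}=\langle s_x,s_y,s_z\rangle$ and $\mathcal{G}_{A,B,C}=\langle g_x,g_y,g_z\rangle$ with $g_x=s_z\circ s_y$, $g_y=s_x\circ s_z$, $g_z=s_y\circ s_x$, considered as groups of automorphisms of $\mathbb{C}^3$;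 the group of restrictions of $\mathcal{G}_{A,B,C}$ to $S_{A,B,C,D}$ is denoted $\mathcal{G}_{A,B,C,D}$. $B_\epsilon(p)$ is the open Euclidean ball in $\mathbb{C}^3$. Fatou components: a sequence of maps $f_i$ converges to infinity on an open set $U\subset S_{A,B,C,D}$ if for every compact $\overline V\subset U$ and every compact $K\subset S_{A,B,C,D}$ only finitely many $i$ satisfy $f_i(\overline V)\cap K\neq\emptyset$. The group $\mathcal{G}_{A,B,C,D}$ forms a normal family on $U$ if every sequence of its elements has a subsequence that, on $U$, either converges uniformly on compact subsets or converges to infinity. The Fatou set is the set of $p\in S_{A,B,C,D}$ having an open neighborhood on which $\mathcal{G}_{A,B,C,D}$ forms a normal family. A Fatou component is a connected component of the Fatou set; it is unbounded if it is unbounded in $\mathbb{C}^3$. Behavior at infinity: let $\overline{S}_{A,B,C,D}$ be the closure of $S_{A,B,C,D}$ in $\mathbb{CP}^3$ with homogeneous coordinates $(X:Y:Z:W)$, $(x,y,z)=(X/W,Y/W,Z/W)$. It meets the plane $\{W=0\}$ in the triangle $\Delta_\infty=\{W=0,\ XYZ=0\}$, with vertices $v_1=(1:0:0:0)$, $v_2=(0:1:0:0)$, $v_3=(0:0:1:0)$, and $\overline{S}_{A,B,C,D}$ is smooth near $\Delta_\infty$. Words in $s_x,s_y,s_z$ are reduced if no two consecutive letters coincide, and cyclically reduced if every cyclic permutation of the word is reduced. An element $\gamma\in\mathcal{G}_{A,B,C}$ is hyperbolic if it is conjugate in $\mathcal{G}^\pm_{A,B,C}$ to a cyclically reduced word in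 $s_x,s_y,s_z$ that contains all three of these maps. For a hyperbolic $\gamma$, its birational extension to the surface $\overline{S}_{A,B,C,D}$ has a single indeterminacy point, which is a vertex of $\Delta_\infty$ denoted ${\rm Ind}(\gamma)$, and it contracts all of $\Delta_\infty\setminus\{{\rm Ind}(\gamma)\}$ to a vertex of $\Delta_\infty$ denoted ${\rm Attr}(\gamma)$; these vertices depend only on the spelling of $\gamma$ as a word in $s_x,s_y,s_z$, not on $A,B,C,D$. *)

theory Defs
  imports "HOL-Analysis.Analysis" "HOL-Algebra.Bij" "HOL-Algebra.Generated_Groups"
begin

definition S :: "complex \<Rightarrow> complex \<Rightarrow> complex \<Rightarrow> complex \<Rightarrow> (complex^3) set" where
  "S A B C D = {p. (p$1)^2 + (p$2)^2 + (p$3)^2 + p$1 * p$2 * p$3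
                   = A * p$1 + B * p$2 + C * p$3 + D}"

definition s_x :: "complex \<Rightarrow> complex^3 \<Rightarrow> complex^3" where
  "s_x A p = vector [- p$1 - p$2 * p$3 + A, p$2, p$3]"

definition s_y :: "complex \<Rightarrow> complex^3 \<Rightarrow> complex^3" where
  "s_y B p = vector [p$1, - p$2 - p$1 * p$3 + B, p$3]"

definition s_z :: "complex \<Rightarrow> complex^3 \<Rightarrow> complex^3" where
  "s_z C p = vector [p$1, p$2, - p$3 - p$1 * p$2 + C]"

definition Gpm :: "complex \<Rightarrow> complex \<Rightarrow> complex \<Rightarrow> (complex^3 \<Rightarrow> complex^3) set" where
  "Gpm A B C = generate (BijGroup UNIV) {s_x A, s_y B, s_z C}"

definition G :: "complex \<Rightarrow> complex \<Rightarrow> complex \<Rightarrow> (complex^3 \<Rightarrow> complex^3) set" where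
  "G A B C = generate (BijGroup UNIV) {s_z C \<circ> s_y B, s_x A \<circ> s_z C, s_y B \<circ> s_x A}"

definition G_on ::
  "complex \<Rightarrow> complex \<Rightarrow> complex \<Rightarrow> complex \<Rightarrow> (complex^3 \<Rightarrow> complex^3) set" where
  "G_on A B C D = (\<lambda>\<gamma>. restrict \<gamma> (S A B C D)) ` G A B C"

datatype letter = LX | LY | LZ

fun letter_map :: "complex \<Rightarrow> complex \<Rightarrow> complex \<Rightarrow> letter \<Rightarrow> complex^3 \<Rightarrow> complex^3" where
  "letter_map A B C LX = s_x A"
| "letter_map A B C LY = s_y B"
| "letter_map A B C LZ = s_z C"

definition word_map ::
  "complex \<Rightarrow> complex \<Rightarrow> complex \<Rightarrow> letter list \<Rightarrow> complex^3 \<Rightarrow> complex^3" where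
  "word_map A B C w = foldr (\<circ>) (map (letter_map A B C) w) id"

definition reduced :: "letter list \<Rightarrow> bool" where
  "reduced w \<longleftrightarrow> distinct_adj w"

definition cyclically_reduced :: "letter list \<Rightarrow> bool" where
  "cyclically_reduced w \<longleftrightarrow> (\<forall>n. reduced (rotate n w))"

definition hyperbolic ::
  "complex \<Rightarrow> complex \<Rightarrow> complex \<Rightarrow> (complex^3 \<Rightarrow> complex^3) \<Rightarrow> bool" where
  "hyperbolic A B C \<gamma> \<longleftrightarrow> \<gamma> \<in> G A B C \<and>
     (\<exists>h\<in>Gpm A B C. \<exists>w. cyclically_reduced w \<and> set w = {LX, LY, LZ} \<and>
        \<gamma> = h \<circ> word_map A B C w \<circ> inv_into UNIV h)"

definition conv_to_infinity ::
  "(complex^3) set \<Rightarrow> (complex^3) set \<Rightarrow> (nat \<Rightarrow> complex^3 \<Rightarrow> complex^3) \<Rightarrow> bool" where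
  "conv_to_infinity X U f \<longleftrightarrow>
     (\<forall>V K. compact V \<and> V \<subseteq> U \<and> compact K \<and> K \<subseteq> X \<longrightarrow> finite {i. f i ` V \<inter> K \<noteq> {}})"

definition conv_locally_uniformly ::
  "(complex^3) set \<Rightarrow> (nat \<Rightarrow> complex^3 \<Rightarrow> complex^3) \<Rightarrow> bool" where
  "conv_locally_uniformly U f \<longleftrightarrow>
     (\<exists>g. \<forall>V. compact V \<and> V \<subseteq> U \<longrightarrow> uniform_limit V f g sequentially)"

definition normal_on ::
  "(complex^3) set \<Rightarrow> (complex^3 \<Rightarrow> complex^3) set \<Rightarrow> (complex^3) set \<Rightarrow> bool" where
  "normal_on X F U \<longleftrightarrow>
     (\<forall>f :: nat \<Rightarrow> complex^3 \<Rightarrow> complex^3. (\<forall>i. f i \<in> F) \<longrightarrow>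
        (\<exists>r :: nat \<Rightarrow> nat. strict_mono r \<and>
           (conv_locally_uniformly U (f \<circ> r) \<or> conv_to_infinity X U (f \<circ> r))))"

definition fatou_set ::
  "complex \<Rightarrow> complex \<Rightarrow> complex \<Rightarrow> complex \<Rightarrow> (complex^3) set" where
  "fatou_set A B C D = {p \<in> S A B C D.
     \<exists>U. openin (top_of_set (S A B C D)) U \<and> p \<in> U \<and> normal_on (S A B C D) (G_on A B C D) U}"

definition fatou_component ::
  "complex \<Rightarrow> complex \<Rightarrow> complex \<Rightarrow> complex \<Rightarrow> (complex^3) set \<Rightarrow> bool" where
  "fatou_component A B C D \<Omega> \<longleftrightarrow> \<Omega> \<in> components (fatou_set A B C D)"

definition proportional :: "complex^4 \<Rightarrow> complex^4 \<Rightarrow> bool" where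
  "proportional v w \<longleftrightarrow> v \<noteq> 0 \<and> w \<noteq> 0 \<and> (\<exists>c. w = c *s v)"

lemma part_equivp_proportional: "part_equivp proportional"
proof (rule part_equivpI)
  show "\<exists>v. proportional v v"
    by (rule exI[of _ "1 :: complex^4"])
      (auto simp: proportional_def vec_eq_iff intro!: exI[of _ "1 :: complex"])
  show "symp proportional"
  proof (rule sympI)
    fix v w assume *: "proportional v w"
    then obtain c where c: "w = c *s v" and nz: "v \<noteq> 0" "w \<noteq> 0"
      by (auto simp: proportional_def)
    from c nz have "c \<noteq> 0" by auto
    with c have "v = inverse c *s w" by (simp add: vec_eq_iff)
    with nz show "proportional w v" by (auto simp: proportional_def)
  qed
  show "transp proportional"
    by (rule transpI) (auto simp: proportional_def)
qed

quotient_type cp3 = "complex^4" / partial: proportional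
  by (rule part_equivp_proportional)

text \<open>The point with homogeneous coordinates \<open>v = (X, Y, Z, W)\<close>, for \<open>v \<noteq> 0\<close>, is
  \<^term>\<open>abs_cp3 v\<close>; the term \<^term>\<open>rep_cp3 q\<close> is some choice of homogeneous coordinates
  of \<open>q\<close>. The topology is the quotient topology.\<close>

instantiation cp3 :: topological_space
begin

definition open_cp3 :: "cp3 set \<Rightarrow> bool" where
  "open_cp3 U \<longleftrightarrow> open {v. v \<noteq> 0 \<and> abs_cp3 v \<in> U}"

instance
proof
  have "{v :: complex^4. v \<noteq> 0 \<and> abs_cp3 v \<in> UNIV} = - {0}" by auto
  then show "open (UNIV :: cp3 set)"
    by (simp only: open_cp3_def open_Compl closed_singleton)
next
  fix U V :: "cp3 set"
  assume "open U" "open V"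
  then have "open ({v. v \<noteq> 0 \<and> abs_cp3 v \<in> U} \<inter> {v. v \<noteq> 0 \<and> abs_cp3 v \<in> V})"
    by (intro open_Int) (simp_all add: open_cp3_def)
  also have "{v. v \<noteq> 0 \<and> abs_cp3 v \<in> U} \<inter> {v. v \<noteq> 0 \<and> abs_cp3 v \<in> V}
      = {v. v \<noteq> 0 \<and> abs_cp3 v \<in> U \<inter> V}" by auto
  finally show "open (U \<inter> V)" by (simp only: open_cp3_def)
next
  fix \<U> :: "cp3 set set"
  assume "\<forall>U\<in>\<U>. open U"
  then have "open (\<Union>U\<in>\<U>. {v. v \<noteq> 0 \<and> abs_cp3 v \<in> U})"
    by (intro open_UN) (simp add: open_cp3_def)
  also have "(\<Union>U\<in>\<U>. {v. v \<noteq> 0 \<and> abs_cp3 v \<in> U}) = {v. v \<noteq> 0 \<and> abs_cp3 v \<in> \<Union>\<U>}" by auto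
  finally show "open (\<Union>\<U>)" by (simp only: open_cp3_def)
qed

end

definition homog :: "complex^3 \<Rightarrow> complex^4" where
  "homog p = vector [p$1, p$2, p$3, 1]"

definition S_bar :: "complex \<Rightarrow> complex \<Rightarrow> complex \<Rightarrow> complex \<Rightarrow> cp3 set" where
  "S_bar A B C D = closure ((\<lambda>p. abs_cp3 (homog p)) ` S A B C D)"

definition Delta_inf :: "cp3 set" where
  "Delta_inf = {q. rep_cp3 q $ 4 = 0 \<and> rep_cp3 q $ 1 * rep_cp3 q $ 2 * rep_cp3 q $ 3 = 0}"

definition V_inf :: "cp3 set" where
  "V_inf = {abs_cp3 (vector [1, 0, 0, 0]), abs_cp3 (vector [0, 1, 0, 0]),
            abs_cp3 (vector [0, 0, 1, 0])}"

inductive hom_poly :: "nat \<Rightarrow> (complex^4 \<Rightarrow> complex) \<Rightarrow> bool" where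
  const: "hom_poly 0 (\<lambda>_. c)"
| coord: "hom_poly 1 (\<lambda>v. v $ i)"
| add: "hom_poly d f \<Longrightarrow> hom_poly d g \<Longrightarrow> hom_poly d (\<lambda>v. f v + g v)"
| mult: "hom_poly d f \<Longrightarrow> hom_poly e g \<Longrightarrow> hom_poly (d + e) (\<lambda>v. f v * g v)"

text \<open>The rational map from the projective closure of the surface to projective space given by
  \<open>\<gamma>\<close> is regular at \<open>q\<close> with value \<open>r\<close>: near \<open>q\<close> it is given by forms of the same degree without
  common zero at \<open>q\<close>. Since the surface is irreducible, agreement with \<open>\<gamma>\<close> near \<open>q\<close> is the same
  as agreement wherever the forms have no common zero.\<close>

definition extends_at ::
  "complex \<Rightarrow> complex \<Rightarrow> complex \<Rightarrow> complex \<Rightarrow> (complex^3 \<Rightarrow> complex^3) \<Rightarrow> cp3 \<Rightarrow> cp3 \<Rightarrow> bool" where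
  "extends_at A B C D \<gamma> q r \<longleftrightarrow>
     (\<exists>d. \<exists>F :: complex^4 \<Rightarrow> complex^4.
        (\<forall>i. hom_poly d (\<lambda>v. F v $ i)) \<and>
        (\<forall>p\<in>S A B C D. F (homog p) \<noteq> 0 \<longrightarrow> abs_cp3 (F (homog p)) = abs_cp3 (homog (\<gamma> p))) \<and>
        F (rep_cp3 q) \<noteq> 0 \<and> r = abs_cp3 (F (rep_cp3 q)))"

definition indeterminacy ::
  "complex \<Rightarrow> complex \<Rightarrow> complex \<Rightarrow> complex \<Rightarrow> (complex^3 \<Rightarrow> complex^3) \<Rightarrow> cp3 set" where
  "indeterminacy A B C D \<gamma> = {q \<in> S_bar A B C D. \<nexists>r. extends_at A B C D \<gamma> q r}"

text \<open>For hyperbolic \<open>\<gamma>\<close> the vertices \<open>Ind(\<gamma>)\<close> and \<open>Attr(\<gamma>)\<close> are the same on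
  all the surfaces preserved by \<open>\<gamma>\<close>, hence the quantification over \<open>D\<close> in their
  defining properties.\<close>

definition is_Ind ::
  "complex \<Rightarrow> complex \<Rightarrow> complex \<Rightarrow> (complex^3 \<Rightarrow> complex^3) \<Rightarrow> cp3 \<Rightarrow> bool" where
  "is_Ind A B C \<gamma> v \<longleftrightarrow> v \<in> V_inf \<and> (\<forall>D. indeterminacy A B C D \<gamma> = {v})"

definition is_Attr ::
  "complex \<Rightarrow> complex \<Rightarrow> complex \<Rightarrow> (complex^3 \<Rightarrow> complex^3) \<Rightarrow> cp3 \<Rightarrow> bool" where
  "is_Attr A B C \<gamma> v \<longleftrightarrow> v \<in> V_inf \<and>
     (\<forall>D. \<forall>q \<in> Delta_inf - indeterminacy A B C D \<gamma>. extends_at A B C D \<gamma> q v)"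

end

theory Submission
  imports Defs "HOL-Complex_Analysis.Conformal_Mappings"
begin

text \<open>
  Near infinity the group acts by ping-pong: on the region where coordinate \<open>a\<close> dominates, every
  letter other than \<open>a\<close> maps into its own region and at least doubles the dominant coordinate. A
  reduced word therefore has its indeterminacy point at the vertex of its rightmost letter and its
  attracting point at the vertex of its leftmost letter, and prescribing these vertices is exactly
  what excludes cancellation in commutators. If \<open>f\<close>, \<open>g\<close> are \<open>\<delta>\<close>-close to the identity, then by
  Schwarz's lemma their commutator is \<open>O(\<delta>\<^sup>2)\<close>-close on a slightly smaller ball, so iterated
  commutators \<open>g m\<close> of the \<open>\<gamma>\<^sub>i\<^sub>j\<close> keep points of the half ball bounded, while their word length
  tends to infinity. Let \<open>z\<close> be a point of an unbounded Fatou component sufficiently close to a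
  point at infinity other than \<open>v\<^sub>i\<close>. Then \<open>\<gamma>\<^sub>i\<^sub>j z\<close> lies in the region of \<open>v\<^sub>j\<close>, hence
  \<open>g m (\<gamma>\<^sub>i\<^sub>j z)\<close> tends to infinity as \<open>m\<close> grows. But by normality the set of points escaping under
  \<open>g m \<circ> \<gamma>\<^sub>i\<^sub>j\<close> is open and closed in the Fatou component, so the component cannot meet the half ball.
\<close>

section \<open>Ping-pong regions near the vertices at infinity\<close>

fun coord :: "letter \<Rightarrow> complex^3 \<Rightarrow> complex" where
  "coord LX p = p$1" | "coord LY p = p$2" | "coord LZ p = p$3"

lemma all_letter: "(\<forall>a. P a) \<longleftrightarrow> P LX \<and> P LY \<and> P LZ"
  by (metis letter.exhaust)

text \<open>On the surface, these regions with \<open>R\<close> large are the neighbourhoods of the vertex \<open>a\<close>: there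
  \<open>x\<^sup>2 + x y z\<close> is negligible against \<open>x\<^sup>2\<close>, so \<open>x\<close> is comparable to \<open>y z\<close> (case \<open>a = LX\<close>).\<close>

definition end_region :: "real \<Rightarrow> letter \<Rightarrow> (complex^3) set" where
  "end_region R a = {p. (\<forall>b. R < norm (coord b p)) \<and>
     norm (p$1) * norm (p$2) * norm (p$3) \<le> 4 * (norm (coord a p))\<^sup>2}"

text \<open>Cancelling \<open>norm x\<close> in the product bound gives
  \<open>norm y * norm z \<le> 4 * norm x\<close>, hence \<open>norm y \<le> norm x\<close>. Since
  also \<open>norm c < norm x\<close> and \<open>norm z > 16\<close>, the term \<open>x * z\<close>
  dominates \<open>y'\<close>.\<close>

lemma step_estimate:
  fixes x y z c :: complex
  assumes R: "16 + norm c \<le> R"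
    and x: "R < norm x" and y: "R < norm y" and z: "R < norm z"
    and le: "norm x * norm y * norm z \<le> 4 * (norm x)\<^sup>2"
  defines "y' \<equiv> - y - x * z + c"
  shows "R < norm y'" "norm x * norm y' * norm z \<le> 4 * (norm y')\<^sup>2" "2 * norm x \<le> norm y'"
proof -
  have pos: "norm x > 0" "norm z > 16" "norm y > 0" using assms norm_ge_zero[of c] by linarith+
  have "norm x * (norm y * norm z) \<le> norm x * (4 * norm x)"
    using le by (simp add: power2_eq_square algebra_simps)
  then have yz: "norm y * norm z \<le> 4 * norm x" using pos by simp
  have "norm y * 4 \<le> norm y * norm z" using pos by (intro mult_left_mono) auto
  then have yx: "norm y \<le> norm x" using yz by linarith
  have "norm (x * z) \<le> norm y' + norm y + norm c"
  proof -
    have "x * z = c - y - y'" by (simp add: y'_def)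
    then have "norm (x * z) = norm (c - y - y')" by simp
    also have "\<dots> \<le> norm (c - y) + norm y'" by (rule norm_triangle_ineq4)
    also have "\<dots> \<le> norm c + norm y + norm y'" using norm_triangle_ineq4[of c y] by simp
    finally show ?thesis by simp
  qed
  then have big: "norm x * norm z \<le> norm y' + 2 * norm x"
    using yx x R by (simp add: norm_mult)
  have "norm x * 16 \<le> norm x * norm z" using pos by (intro mult_left_mono) auto
  then show y2: "2 * norm x \<le> norm y'" using big pos by linarith
  then show "R < norm y'" using x pos by linarith
  have "norm x * norm z \<le> 4 * norm y'" using big y2 pos by linarith
  then have "norm y' * (norm x * norm z) \<le> norm y' * (4 * norm y')"
    by (intro mult_left_mono) auto
  then show "norm x * norm y' * norm z \<le> 4 * (norm y')\<^sup>2"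
    by (simp add: power2_eq_square algebra_simps)
qed

text \<open>Each of the six pairs of distinct letters is \<open>step_estimate\<close> with
  coordinates permuted; \<open>R\<close> is large enough for all three parameters.\<close>

lemma letter_map_end_region:
  assumes R: "16 + norm A + norm B + norm C \<le> R" and p: "p \<in> end_region R a" and ab: "b \<noteq> a"
  shows "letter_map A B C b p \<in> end_region R b" "2 * norm (coord a p) \<le> norm (coord b (letter_map A B C b p))"
proof -
  have c: "16 + norm A \<le> R" "16 + norm B \<le> R" "16 + norm C \<le> R"
    using R norm_ge_zero[of A] norm_ge_zero[of B] norm_ge_zero[of C] by linarith+
  have co: "R < norm (p$1)" "R < norm (p$2)" "R < norm (p$3)"
    using p by (auto simp: end_region_def all_letter)
  have le: "norm (p$1) * norm (p$2) * norm (p$3) \<le> 4 * (norm (coord a p))\<^sup>2"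
    using p by (auto simp: end_region_def)
  have "letter_map A B C b p \<in> end_region R b \<and> 2 * norm (coord a p) \<le> norm (coord b (letter_map A B C b p))"
  proof -
    consider "a = LX" "b = LY" | "a = LX" "b = LZ" | "a = LY" "b = LX" | "a = LY" "b = LZ" | "a = LZ" "b = LX" | "a = LZ" "b = LY"
      using ab by (cases a; cases b) auto
    then show ?thesis
    proof cases
    case 1
    have "norm (p$1) * norm (p$2) * norm (p$3) \<le> 4 * (norm (p$1))\<^sup>2"
      using le 1 by (simp add: mult_ac)
    from step_estimate[OF c(2) co(1) co(2) co(3) this] co 1 show ?thesis
      by (simp add: end_region_def all_letter s_x_def s_y_def s_z_def mult_ac)
    next
    case 2
    have "norm (p$1) * norm (p$3) * norm (p$2) \<le> 4 * (norm (p$1))\<^sup>2"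
      using le 2 by (simp add: mult_ac)
    from step_estimate[OF c(3) co(1) co(3) co(2) this] co 2 show ?thesis
      by (simp add: end_region_def all_letter s_x_def s_y_def s_z_def mult_ac)
    next
    case 3
    have "norm (p$2) * norm (p$1) * norm (p$3) \<le> 4 * (norm (p$2))\<^sup>2"
      using le 3 by (simp add: mult_ac)
    from step_estimate[OF c(1) co(2) co(1) co(3) this] co 3 show ?thesis
      by (simp add: end_region_def all_letter s_x_def s_y_def s_z_def mult_ac)
    next
    case 4
    have "norm (p$2) * norm (p$3) * norm (p$1) \<le> 4 * (norm (p$2))\<^sup>2"
      using le 4 by (simp add: mult_ac)
    from step_estimate[OF c(3) co(2) co(3) co(1) this] co 4 show ?thesis
      by (simp add: end_region_def all_letter s_x_def s_y_def s_z_def mult_ac)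
    next
    case 5
    have "norm (p$3) * norm (p$1) * norm (p$2) \<le> 4 * (norm (p$3))\<^sup>2"
      using le 5 by (simp add: mult_ac)
    from step_estimate[OF c(1) co(3) co(1) co(2) this] co 5 show ?thesis
      by (simp add: end_region_def all_letter s_x_def s_y_def s_z_def mult_ac)
    next
    case 6
    have "norm (p$3) * norm (p$2) * norm (p$1) \<le> 4 * (norm (p$3))\<^sup>2"
      using le 6 by (simp add: mult_ac)
    from step_estimate[OF c(2) co(3) co(2) co(1) this] co 6 show ?thesis
      by (simp add: end_region_def all_letter s_x_def s_y_def s_z_def mult_ac)
    qed
  qed
  then show "letter_map A B C b p \<in> end_region R b" "2 * norm (coord a p) \<le> norm (coord b (letter_map A B C b p))"
    by auto
qed

section \<open>Reduced words and their action on the regions\<close>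

lemma word_map_Nil [simp]: "word_map A B C [] = id"
  by (simp add: word_map_def)

lemma word_map_Cons [simp]: "word_map A B C (a # w) = letter_map A B C a \<circ> word_map A B C w"
  by (simp add: word_map_def)

lemma word_map_append: "word_map A B C (v @ w) = word_map A B C v \<circ> word_map A B C w"
  by (induction v) (auto simp: comp_assoc)

lemma letter_map_involution [simp]: "letter_map A B C a (letter_map A B C a p) = p"
  by (cases a) (simp_all add: s_x_def s_y_def s_z_def vec_eq_iff forall_3)

lemma word_map_rev: "word_map A B C (rev w) (word_map A B C w p) = p"
  by (induction w arbitrary: p) (auto simp: word_map_append)

lemma bij_word_map: "bij (word_map A B C w)"
  by (rule o_bij[where g = "word_map A B C (rev w)"])
    (auto simp: fun_eq_iff word_map_rev word_map_rev[of A B C "rev w", simplified])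

lemma inv_word_map: "inv_into UNIV (word_map A B C w) = word_map A B C (rev w)"
  by (rule inv_equality) (auto simp: word_map_rev word_map_rev[of A B C "rev w", simplified])

text \<open>Letters are involutions, so a letter prepended to a reduced word that begins with it
  cancels against that first letter.\<close>

lemma ex_reduced_word: "\<exists>v. reduced v \<and> word_map A B C v = word_map A B C w"
proof (induction w)
  case Nil
  show ?case by (rule exI[of _ "[]"]) (auto simp: reduced_def)
next
  case (Cons a w)
  then obtain v where v: "reduced v" "word_map A B C v = word_map A B C w" by auto
  show ?case
  proof (cases "v \<noteq> [] \<and> hd v = a")
    case True
    then obtain u where u: "v = a # u" by (cases v) auto
    have "reduced u" using v(1) u by (cases u) (auto simp: reduced_def)
    moreover have "word_map A B C u = word_map A B C (a # w)"
      using v(2)[symmetric] u by (auto simp: fun_eq_iff)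
    ultimately show ?thesis by blast
  next
    case False
    then have "reduced (a # v)" using v(1) by (cases v) (auto simp: reduced_def)
    then show ?thesis using v(2) by (intro exI[of _ "a # v"]) auto
  qed
qed

text \<open>The rightmost letter acts first, so the starting region only has to avoid
  \<open>last w\<close>. Reducedness makes every later letter differ from the one naming the current
  region, and each letter contributes a factor 2.\<close>

lemma word_map_end_region:
  assumes R: "16 + norm A + norm B + norm C \<le> R" and w: "reduced w" "w \<noteq> []"
    and p: "p \<in> end_region R a" and a: "a \<noteq> last w"
  shows "word_map A B C w p \<in> end_region R (hd w) \<and>
    2 ^ length w * norm (coord a p) \<le> norm (coord (hd w) (word_map A B C w p))"
  using w a
proof (induction w)
  case (Cons b w)
  show ?case
  proof (cases "w = []")
    case True
    then show ?thesis using Cons.prems letter_map_end_region[OF R p, of b] by auto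
  next
    case False
    then have "reduced w" "hd w \<noteq> b" using Cons.prems(1) by (cases w; auto simp: reduced_def)+
    then have IH: "word_map A B C w p \<in> end_region R (hd w)"
      "2 ^ length w * norm (coord a p) \<le> norm (coord (hd w) (word_map A B C w p))"
      using Cons.IH False Cons.prems by auto
    have "2 ^ length (b # w) * norm (coord a p) = 2 * (2 ^ length w * norm (coord a p))" by simp
    also have "\<dots> \<le> 2 * norm (coord (hd w) (word_map A B C w p))" using IH(2) by (rule mult_left_mono) simp
    also have "\<dots> \<le> norm (coord b (letter_map A B C b (word_map A B C w p)))"
      using letter_map_end_region(2)[OF R IH(1)] \<open>hd w \<noteq> b\<close> by metis
    finally show ?thesis
      using letter_map_end_region(1)[OF R IH(1)] \<open>hd w \<noteq> b\<close> unfolding list.sel word_map_Cons o_apply by metis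
  qed
qed simp

section \<open>Group elements as words, and the invariant surfaces\<close>

lemma bij_in_Bij: "f \<in> Bij UNIV \<longleftrightarrow> bij f"
  by (simp add: Bij_def extensional_def)

lemma mult_BijGroup_UNIV [simp]: "bij f \<Longrightarrow> bij g \<Longrightarrow> f \<otimes>\<^bsub>BijGroup UNIV\<^esub> g = f \<circ> g"
  by (simp add: BijGroup_def bij_in_Bij compose_def fun_eq_iff)

lemma inv_BijGroup_UNIV [simp]: "bij f \<Longrightarrow> inv\<^bsub>BijGroup UNIV\<^esub> f = inv_into UNIV f"
  by (simp add: inv_BijGroup bij_in_Bij restrict_def)

lemma carrier_BijGroup_UNIV: "f \<in> carrier (BijGroup UNIV) \<longleftrightarrow> bij f"
  by (simp add: BijGroup_def bij_in_Bij)

lemma G_imp_word_map: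
  assumes "\<gamma> \<in> G A B C"
  shows "\<exists>w. \<gamma> = word_map A B C w"
proof -
  have gen: "\<exists>w. g = word_map A B C w \<and> bij g" if "g \<in> {s_z C \<circ> s_y B, s_x A \<circ> s_z C, s_y B \<circ> s_x A}" for g
  proof -
    have "s_z C \<circ> s_y B = word_map A B C [LZ, LY]" "s_x A \<circ> s_z C = word_map A B C [LX, LZ]"
      "s_y B \<circ> s_x A = word_map A B C [LY, LX]" by auto
    then have "g = word_map A B C [LZ, LY] \<or> g = word_map A B C [LX, LZ] \<or> g = word_map A B C [LY, LX]"
      using that by (elim insertE emptyE) (simp_all only: simp_thms)
    then show ?thesis using bij_word_map by blast
  qed
  show ?thesis using assms unfolding G_def
  proof (induction rule: generate.induct)
    case one
    show ?case by (intro exI[of _ "[]"]) (auto simp: BijGroup_def)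
  next
    case (incl h)
    then show ?case using gen by blast
  next
    case (inv h)
    then obtain w where "h = word_map A B C w" "bij h" using gen by blast
    then show ?case using inv_word_map by (intro exI[of _ "rev w"]) auto
  next
    case (eng h1 h2)
    then obtain v w where "h1 = word_map A B C v" "h2 = word_map A B C w" by blast
    then show ?case using bij_word_map word_map_append by (intro exI[of _ "v @ w"]) simp
  qed
qed

lemma G_imp_bij: "\<gamma> \<in> G A B C \<Longrightarrow> bij \<gamma>"
  using G_imp_word_map bij_word_map by metis

lemma bij_s: "bij (s_x A)" "bij (s_y B)" "bij (s_z C)"
  using bij_word_map[of A B C "[LX]"] bij_word_map[of A B C "[LY]"] bij_word_map[of A B C "[LZ]"]
  by auto

lemma subgroup_G: "subgroup (G A B C) (BijGroup UNIV)"
  unfolding G_def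
  by (rule group.generate_is_subgroup[OF group_BijGroup])
    (auto simp: carrier_BijGroup_UNIV intro!: bij_comp bij_s)

lemma G_comp: "f \<in> G A B C \<Longrightarrow> g \<in> G A B C \<Longrightarrow> f \<circ> g \<in> G A B C"
  using subgroup.m_closed[OF subgroup_G, of f A B C g] by (simp add: G_imp_bij)

lemma G_inv: "f \<in> G A B C \<Longrightarrow> inv_into UNIV f \<in> G A B C"
  using subgroup.m_inv_closed[OF subgroup_G, of f A B C] by (simp add: G_imp_bij)

text \<open>With \<open>D\<close> as the level of one polynomial, a single computation shows that
  all the surfaces are invariant.\<close>

definition surface_poly :: "complex \<Rightarrow> complex \<Rightarrow> complex \<Rightarrow> complex^3 \<Rightarrow> complex" where
  "surface_poly A B C p = (p$1)\<^sup>2 + (p$2)\<^sup>2 + (p$3)\<^sup>2 + p$1 * p$2 * p$3 - (A * p$1 + B * p$2 + C * p$3)"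

lemma S_iff: "p \<in> S A B C D \<longleftrightarrow> surface_poly A B C p = D"
  unfolding S_def surface_poly_def mem_Collect_eq diff_eq_eq by (simp add: add.commute)

lemma surface_poly_letter_map: "surface_poly A B C (letter_map A B C a p) = surface_poly A B C p"
  by (cases a)
    (simp_all add: surface_poly_def s_x_def s_y_def s_z_def power2_eq_square algebra_simps)

lemma letter_map_S: "p \<in> S A B C D \<Longrightarrow> letter_map A B C a p \<in> S A B C D"
  by (simp add: S_iff surface_poly_letter_map)

lemma word_map_S: "p \<in> S A B C D \<Longrightarrow> word_map A B C w p \<in> S A B C D"
  by (induction w) (auto simp: letter_map_S)

lemma G_S: "\<gamma> \<in> G A B C \<Longrightarrow> p \<in> S A B C D \<Longrightarrow> \<gamma> p \<in> S A B C D"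
  using G_imp_word_map word_map_S by metis

section \<open>Displacement of commutators\<close>

text \<open>Stated along a curve \<open>h\<close> with one complex parameter, because Schwarz's
  lemma is later applied on complex lines.\<close>

lemma letter_map_holomorphic:
  assumes h: "\<And>i. (\<lambda>t. h t $ i) holomorphic_on X"
  shows "(\<lambda>t. letter_map A B C a (h t) $ i) holomorphic_on X"
proof -
  have "\<forall>i. (\<lambda>t. letter_map A B C a (h t) $ i) holomorphic_on X"
    by (cases a) (auto simp: forall_3 s_x_def s_y_def s_z_def intro!: holomorphic_intros h)
  then show ?thesis by blast
qed

lemma word_map_holomorphic:
  assumes h: "\<And>i. (\<lambda>t. h t $ i) holomorphic_on X"
  shows "(\<lambda>t. word_map A B C w (h t) $ i) holomorphic_on X"
  using h by (induction w arbitrary: i) (auto intro: letter_map_holomorphic)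

lemma continuous_on_vec_nth_iff:
  fixes f :: "'a::topological_space \<Rightarrow> 'b::real_normed_vector^'n"
  shows "continuous_on X f \<longleftrightarrow> (\<forall>i. continuous_on X (\<lambda>x. f x $ i))"
proof
  assume "\<forall>i. continuous_on X (\<lambda>x. f x $ i)"
  then have "continuous_on X (\<lambda>x. \<chi> i. f x $ i)" by (intro continuous_on_vec_lambda) auto
  then show "continuous_on X f" by simp
qed (auto intro: continuous_intros)

lemma continuous_on_letter_map: "continuous_on X (letter_map A B C a)"
  by (cases a) (auto simp: continuous_on_vec_nth_iff forall_3 s_x_def s_y_def s_z_def intro!: continuous_intros)

lemma continuous_on_word_map: "continuous_on X (word_map A B C w)"
proof (induction w)
  case (Cons a w)
  then show ?case
    unfolding word_map_Cons by (intro continuous_on_compose continuous_on_letter_map)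
qed (simp add: id_def)

lemma G_continuous: "\<gamma> \<in> G A B C \<Longrightarrow> continuous_on X \<gamma>"
  using G_imp_word_map continuous_on_word_map by metis

lemma norm_vec_smult: "norm (c *s x) = norm c * norm (x :: complex^'n)"
  by (simp add: norm_vec_def norm_mult L2_set_right_distrib)

lemma norm_vec_le_bound:
  fixes x :: "complex^3"
  assumes "\<And>i. norm (x $ i) \<le> b"
  shows "norm x \<le> 3 * b"
proof -
  have "norm x \<le> (\<Sum>i\<in>UNIV. norm (x $ i))" unfolding norm_vec_def by (rule L2_set_le_sum) simp
  also have "\<dots> \<le> (\<Sum>i\<in>(UNIV::3 set). b)" by (intro sum_mono assms)
  finally show ?thesis by simp
qed

text \<open>Rescale the disc to radius 1 and divide by \<open>2 * \<delta>\<close>, which bounds the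
  difference of two values of \<open>g\<close>; then apply Schwarz's lemma at
  \<open>1 / T\<close>.\<close>

lemma Schwarz_difference:
  fixes g :: "complex \<Rightarrow> complex"
  assumes hol: "g holomorphic_on ball 0 T" and T: "T > 1"
    and bd: "\<And>t. norm t < T \<Longrightarrow> norm (g t) < \<delta>"
  shows "norm (g 1 - g 0) \<le> 2 * \<delta> / T"
proof -
  have \<delta>: "\<delta> > 0" using bd[of 0] T norm_ge_zero[of "g 0"] by (auto simp del: norm_ge_zero)
  define f where "f s = (g (of_real T * s) - g 0) / of_real (2 * \<delta>)" for s
  have img: "(\<lambda>s::complex. of_real T * s) ` ball 0 1 \<subseteq> ball 0 T" 
  proof (rule image_subsetI)
    fix s :: complex assume "s \<in> ball 0 1"
    then have "T * norm s < T * 1" using T by (intro mult_strict_left_mono) auto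
    then show "of_real T * s \<in> ball 0 T" using T by (simp add: norm_mult)
  qed
  have "(g \<circ> (\<lambda>s. of_real T * s)) holomorphic_on ball 0 1"
    by (rule holomorphic_on_compose_gen[OF _ hol img]) (intro holomorphic_intros)
  then have hf: "f holomorphic_on ball 0 1"
    unfolding f_def o_def using \<delta> by (intro holomorphic_intros) auto
  have f1: "norm (f s) < 1" if "norm s < 1" for s
  proof -
    have "norm (g (of_real T * s)) < \<delta>" "norm (g 0) < \<delta>"
      using bd that T by (auto simp: norm_mult)
    then have "norm (g (of_real T * s) - g 0) < 2 * \<delta>"
      using norm_triangle_ineq4[of "g (of_real T * s)" "g 0"] by linarith
    then show ?thesis using \<delta> by (simp add: f_def norm_divide norm_mult)
  qed
  have "norm (f (1 / of_real T)) \<le> norm (1 / of_real T :: complex)"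
    using T by (intro Schwarz_Lemma(1)[OF hf _ f1]) (auto simp: f_def norm_divide)
  then show ?thesis using T \<delta> by (simp add: f_def norm_divide norm_mult field_simps)
qed

text \<open>On the complex line through \<open>u\<close> and \<open>v\<close>, parametrized with
  \<open>u\<close> at 0 and \<open>v\<close> at 1, parameters of norm below
  \<open>T = \<rho> / norm (v - u)\<close> stay in the ball. Schwarz bounds each coordinate by
  \<open>2 * \<delta> / T\<close>; three coordinates give the constant 6.\<close>

lemma displacement_Lipschitz:
  assumes \<gamma>: "\<gamma> \<in> G A B C" and near: "\<And>z. z \<in> ball p r \<Longrightarrow> norm (\<gamma> z - z) < \<delta>"
    and u: "u \<in> ball p (r - \<rho>)" and uv: "norm (v - u) < \<rho>"
  shows "norm ((\<gamma> v - v) - (\<gamma> u - u)) \<le> 6 * \<delta> / \<rho> * norm (v - u)"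
proof (cases "v = u")
  case False
  define T where "T = \<rho> / norm (v - u)"
  have vu: "norm (v - u) > 0" and \<rho>: "\<rho> > 0" using False le_less_trans[OF norm_ge_zero uv] by simp_all
  have T: "T > 1" using uv vu by (simp add: T_def)
  obtain w where w: "\<gamma> = word_map A B C w" using G_imp_word_map[OF \<gamma>] by blast
  have line: "norm (\<gamma> (u + t *s (v - u)) - (u + t *s (v - u))) < \<delta>" if "norm t < T" for t
  proof (rule near)
    define x where "x = t *s (v - u)"
    have "norm x = norm t * norm (v - u)" by (simp only: x_def norm_vec_smult)
    also have "\<dots> < \<rho>" using that vu unfolding T_def by (simp only: pos_less_divide_eq)
    finally have "norm x < \<rho>" .
    moreover have "dist p (u + x) \<le> dist p u + dist u (u + x)" by (rule dist_triangle)
    moreover have "dist u (u + x) = norm x" by (simp add: dist_norm)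
    moreover have "dist p u < r - \<rho>" using u by (simp only: mem_ball)
    ultimately have "u + x \<in> ball p r" unfolding mem_ball by linarith
    then show "u + t *s (v - u) \<in> ball p r" by (simp only: x_def)
  qed
  have "norm (((\<gamma> v - v) - (\<gamma> u - u)) $ i) \<le> 2 * \<delta> / T" for i
  proof -
    define g where "g t = (\<gamma> (u + t *s (v - u)) - (u + t *s (v - u))) $ i" for t
    have "norm (g 1 - g 0) \<le> 2 * \<delta> / T"
    proof (rule Schwarz_difference)
      have "(\<lambda>t. \<gamma> (u + t *s (v - u)) $ i) holomorphic_on ball 0 T"
        unfolding w by (intro word_map_holomorphic) (auto intro!: holomorphic_intros)
      then show "g holomorphic_on ball 0 T"
        unfolding g_def by (auto intro!: holomorphic_intros)
      show "norm (g t) < \<delta>" if "norm t < T" for t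
        unfolding g_def by (rule le_less_trans[OF Finite_Cartesian_Product.norm_nth_le line[OF that]])
    qed (rule T)
    then show ?thesis by (simp add: g_def)
  qed
  then have "norm ((\<gamma> v - v) - (\<gamma> u - u)) \<le> 3 * (2 * \<delta> / T)" by (rule norm_vec_le_bound)
  also have "3 * (2 * \<delta> / T) = 6 * \<delta> / \<rho> * norm (v - u)" unfolding T_def by simp
  finally show ?thesis .
qed simp

text \<open>By Brouwer, \<open>z\<close> has a preimage within \<delta>: the map taking
  \<open>y\<close> to \<open>z + (y - f y)\<close> preserves \<open>cball z \<delta>\<close>.
  Bijectivity identifies this preimage with the value of the inverse.\<close>

lemma inverse_displacement:
  fixes f :: "'a::euclidean_space \<Rightarrow> 'a"
  assumes f: "bij f" "continuous_on UNIV f"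
    and near: "\<And>x. x \<in> ball p r \<Longrightarrow> norm (f x - x) < \<delta>"
    and \<delta>: "\<delta> > 0" and z: "z \<in> ball p (r - \<delta>)"
  shows "norm (inv_into UNIV f z - z) < \<delta>"
proof -
  have sub: "cball z \<delta> \<subseteq> ball p r"
  proof
    fix x assume "x \<in> cball z \<delta>"
    then show "x \<in> ball p r" using z dist_triangle[of p x z] by simp
  qed
  have "\<exists>x\<in>cball z \<delta>. f x = z"
  proof (rule brouwer_surjective[where S = "{z}"])
    show "continuous_on (cball z \<delta>) f" using f(2) continuous_on_subset by blast
    show "x + (y - f y) \<in> cball z \<delta>" if "x \<in> {z}" "y \<in> cball z \<delta>" for x y
    proof -
      have "norm (f y - y) < \<delta>" using subsetD[OF sub that(2)] by (rule near)
      moreover have "dist z (z + (y - f y)) = norm (f y - y)" by (simp add: dist_norm norm_minus_commute)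
      ultimately show ?thesis using that(1) by simp
    qed
  qed (use \<delta> in auto)
  then obtain x where x: "x \<in> cball z \<delta>" "f x = z" by blast
  then have "inv_into UNIV f z = x" using f(1) by (simp add: bij_is_inj inv_f_eq)
  then show ?thesis using near[of x] x sub by (auto simp: norm_minus_commute)
qed

definition commutator :: "('a \<Rightarrow> 'a) \<Rightarrow> ('a \<Rightarrow> 'a) \<Rightarrow> 'a \<Rightarrow> 'a" where
  "commutator f g = f \<circ> g \<circ> (inv_into UNIV f \<circ> inv_into UNIV g)"

lemma G_commutator: "f \<in> G A B C \<Longrightarrow> g \<in> G A B C \<Longrightarrow> commutator f g \<in> G A B C"
  by (simp add: commutator_def G_comp G_inv)

text \<open>With \<open>u\<close> the image of \<open>z\<close> under both inverses, the
  displacement is \<open>f (g u) - g (f u)\<close>, a difference of increments of displacements, so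
  Lipschitz bounds give a quadratic estimate. Of the lost radius \<open>2 * \<rho>\<close>, one
  \<rho> pays for the two inverses and the other for Schwarz's lemma.\<close>

lemma commutator_displacement:
  assumes f: "f \<in> G A B C" and g: "g \<in> G A B C"
    and nf: "\<And>z. z \<in> ball p r \<Longrightarrow> norm (f z - z) < \<delta>"
    and ng: "\<And>z. z \<in> ball p r \<Longrightarrow> norm (g z - z) < \<delta>"
    and \<delta>: "\<delta> > 0" and \<rho>: "2 * \<delta> \<le> \<rho>" and z: "z \<in> ball p (r - 2 * \<rho>)"
  shows "norm (commutator f g z - z) < 13 * \<delta>\<^sup>2 / \<rho>"
proof -
  have \<rho>0: "\<rho> > 0" using \<delta> \<rho> by simp
  define w where "w = inv_into UNIV g z"
  define u where "u = inv_into UNIV f w"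
  have wz: "norm (w - z) < \<delta>" unfolding w_def
    by (rule inverse_displacement[OF G_imp_bij[OF g] G_continuous[OF g] ng]) (use \<delta> \<rho> z in auto)
  have w: "w \<in> ball p (r - 2 * \<rho> + \<delta>)"
    using wz z dist_triangle[of p w z] by (simp add: dist_norm norm_minus_commute)
  have uw: "norm (u - w) < \<delta>" unfolding u_def
    by (rule inverse_displacement[OF G_imp_bij[OF f] G_continuous[OF f] nf]) (use \<delta> \<rho> w in auto)
  have u: "u \<in> ball p (r - \<rho>)"
    using uw w \<rho> dist_triangle[of p u w] by (simp add: dist_norm norm_minus_commute)
  then have ur: "u \<in> ball p r" using \<rho>0 by simp
  have zfg: "z = g (f u)"
    unfolding u_def w_def by (simp add: G_imp_bij[OF f] G_imp_bij[OF g] bij_is_surj surj_f_inv_f)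
  have fu: "norm (f u - u) < \<delta>" and gu: "norm (g u - u) < \<delta>" using nf ng ur by auto
  have "commutator f g z - z = f (g u) - g (f u)"
    by (simp add: commutator_def u_def[symmetric] w_def[symmetric]) (simp add: zfg)
  \<comment> \<open>The linear parts of the two displacements cancel: what remains is the change of
    \<open>f - id\<close> from \<open>u\<close> to \<open>g u\<close> minus that of
    \<open>g - id\<close> from \<open>u\<close> to \<open>f u\<close>.\<close>
  also have "\<dots> = ((f (g u) - g u) - (f u - u)) - ((g (f u) - f u) - (g u - u))" by simp
  finally have "norm (commutator f g z - z)
      \<le> norm ((f (g u) - g u) - (f u - u)) + norm ((g (f u) - f u) - (g u - u))"
    by (metis norm_triangle_ineq4)
  also have "norm ((f (g u) - g u) - (f u - u)) \<le> 6 * \<delta> / \<rho> * norm (g u - u)"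
    by (rule displacement_Lipschitz[OF f nf u]) (use gu \<rho> \<delta> in auto)
  also have "\<dots> \<le> 6 * \<delta> / \<rho> * \<delta>" using gu \<delta> \<rho>0 by (intro mult_left_mono) auto
  also have "norm ((g (f u) - f u) - (g u - u)) \<le> 6 * \<delta> / \<rho> * norm (f u - u)"
    by (rule displacement_Lipschitz[OF g ng u]) (use fu \<rho> \<delta> in auto)
  also have "\<dots> \<le> 6 * \<delta> / \<rho> * \<delta>" using fu \<delta> \<rho>0 by (intro mult_left_mono) auto
  finally have "norm (commutator f g z - z) \<le> 12 * \<delta>\<^sup>2 / \<rho>" by (simp add: power2_eq_square)
  \<comment> \<open>Passing from 12 to 13 makes the bound strict.\<close>
  also have "\<dots> < 13 * \<delta>\<^sup>2 / \<rho>" using \<delta> \<rho>0 by (simp add: divide_strict_right_mono)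
  finally show ?thesis .
qed

section \<open>Points of the surface near infinity\<close>

fun hvert :: "letter \<Rightarrow> complex^4" where
  "hvert LX = vector [1, 0, 0, 0]"
| "hvert LY = vector [0, 1, 0, 0]"
| "hvert LZ = vector [0, 0, 1, 0]"

lemma vector_4_nth [simp]:
  "(vector [x, y, z, w] :: 'a::zero^4) $ 1 = x" "(vector [x, y, z, w] :: 'a::zero^4) $ 2 = y"
  "(vector [x, y, z, w] :: 'a::zero^4) $ 3 = z" "(vector [x, y, z, w] :: 'a::zero^4) $ 4 = w"
  unfolding vector_def by simp_all

lemma V_inf_eq: "V_inf = range (\<lambda>a. abs_cp3 (hvert a))"
proof -
  have *: "(UNIV :: letter set) = {LX, LY, LZ}" using letter.exhaust by blast
  show ?thesis unfolding V_inf_def * by simp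
qed

lemma hvert_nonzero: "hvert a \<noteq> 0"
  by (cases a) (auto simp: vec_eq_iff forall_4)

lemma homog_nonzero: "homog p \<noteq> 0"
  by (auto simp: homog_def vec_eq_iff forall_4)

lemma abs_cp3_eq_iff:
  assumes "v \<noteq> 0" "w \<noteq> 0"
  shows "abs_cp3 v = abs_cp3 w \<longleftrightarrow> (\<exists>c. w = c *s v)"
proof -
  have "proportional v v" "proportional w w"
    using assms by (auto simp: proportional_def intro!: exI[of _ "1::complex"])
  then have "abs_cp3 v = abs_cp3 w \<longleftrightarrow> proportional v w"
    using Quotient3_rel[OF Quotient3_cp3, of v w] by blast
  then show ?thesis using assms by (simp add: proportional_def)
qed

lemma rep_abs_cp3:
  assumes "v \<noteq> 0"
  obtains c where "rep_cp3 (abs_cp3 v) = c *s v" "c \<noteq> 0"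
proof -
  have "proportional v v" using assms by (auto simp: proportional_def intro!: exI[of _ "1::complex"])
  then have "proportional v (rep_cp3 (abs_cp3 v))"
    using rep_abs_rsp[OF Quotient3_cp3, of v v] by blast
  then show ?thesis using that by (auto simp: proportional_def)
qed

lemma abs_hvert_eq_iff: "abs_cp3 (hvert a) = abs_cp3 (hvert b) \<longleftrightarrow> a = b"
proof -
  have "hvert b \<noteq> c *s hvert a" if "a \<noteq> b" for c
    using that by (cases a; cases b) (auto simp: vec_eq_iff forall_4)
  then show ?thesis using abs_cp3_eq_iff[OF hvert_nonzero hvert_nonzero, of a b] by blast
qed

lemma hom_poly_scale: "hom_poly d f \<Longrightarrow> f (c *s v) = c ^ d * f v"
  by (induction rule: hom_poly.induct) (auto simp: algebra_simps power_add)

lemma hom_poly_continuous: "hom_poly d f \<Longrightarrow> continuous_on UNIV f"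
  by (induction rule: hom_poly.induct) (auto intro!: continuous_intros)

text \<open>The two roots sum to \<open>- b\<close>, so one of them has at least half the norm of
  \<open>b\<close>.\<close>

lemma quadratic_large_root:
  fixes b c :: complex
  obtains x where "x\<^sup>2 + b * x + c = 0" "norm b \<le> 2 * norm x"
proof -
  define s where "s = csqrt (b\<^sup>2 - 4 * c)"
  have s: "s\<^sup>2 = b\<^sup>2 - 4 * c" by (simp add: s_def)
  have root: "((- b + t) / 2)\<^sup>2 + b * ((- b + t) / 2) + c = 0" if "t\<^sup>2 = b\<^sup>2 - 4 * c" for t
  proof -
    have "((- b + t) / 2)\<^sup>2 + b * ((- b + t) / 2) + c = (t\<^sup>2 - b\<^sup>2 + 4 * c) / 4"
      by (simp add: field_simps power2_eq_square)
    then show ?thesis using that by simp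
  qed
  have "2 * norm b = norm ((- b + s) + (- b + - s))" by simp
  also have "\<dots> \<le> norm (- b + s) + norm (- b + - s)" by (rule norm_triangle_ineq)
  finally have "norm b \<le> norm (- b + s) \<or> norm b \<le> norm (- b + - s)" by linarith
  then obtain t where t: "t\<^sup>2 = b\<^sup>2 - 4 * c" "norm b \<le> norm (- b + t)"
    using s by (metis power2_minus)
  show ?thesis
    by (rule that[OF root[OF t(1)]]) (use t(2) in \<open>simp add: norm_divide\<close>)
qed

text \<open>With the other two coordinates equal to \<open>t\<close>, the surface equation is
  quadratic in \<open>x\<close> with linear coefficient \<open>t\<^sup>2 - A\<close>; its larger
  root is at least of order \<open>t\<^sup>2\<close>.\<close>

lemma ex_large_solution:
  fixes A B C D :: complex and R :: real
  obtains x t where "x\<^sup>2 + t\<^sup>2 + t\<^sup>2 + x * t * t = A * x + B * t + C * t + D"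
    "R < norm x" "R < norm t" "norm x * norm t * norm t \<le> 4 * (norm x)\<^sup>2"
proof -
  define r where "r = 5 + \<bar>R\<bar> + 2 * norm A"
  define t where "t = complex_of_real r"
  have r: "r \<ge> 5" "r > R" "r \<ge> 2 * norm A"
    using norm_ge_zero[of A] abs_ge_self[of R] abs_ge_zero[of R] unfolding r_def by linarith+
  obtain x where x: "x\<^sup>2 + (t\<^sup>2 - A) * x + (2 * t\<^sup>2 - (B + C) * t - D) = 0"
    and xt: "norm (t\<^sup>2 - A) \<le> 2 * norm x" by (rule quadratic_large_root)
  have nt: "norm t = r" using r by (simp add: t_def)
  have "r * 5 \<le> r\<^sup>2" unfolding power2_eq_square using r by (intro mult_left_mono) auto
  moreover have "r\<^sup>2 \<le> norm (t\<^sup>2 - A) + norm A"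
    using norm_triangle_ineq2[of "t\<^sup>2" A] nt by (simp add: norm_power)
  ultimately have big: "r\<^sup>2 \<le> 4 * norm x" "r < norm x" using xt r by linarith+
  show ?thesis
  proof (rule that)
    show "x\<^sup>2 + t\<^sup>2 + t\<^sup>2 + x * t * t = A * x + B * t + C * t + D"
      using x by (simp add: algebra_simps power2_eq_square)
    have "norm x * r\<^sup>2 \<le> norm x * (4 * norm x)" using big by (intro mult_left_mono) auto
    then show "norm x * norm t * norm t \<le> 4 * (norm x)\<^sup>2"
      unfolding nt by (simp add: power2_eq_square mult_ac)
  qed (use r big nt in auto)
qed

lemma ex_S_end_region: "\<exists>p\<in>S A B C D. p \<in> end_region R a"
proof (cases a)
  case LX
  obtain x t where "x\<^sup>2 + t\<^sup>2 + t\<^sup>2 + x * t * t = A * x + B * t + C * t + D"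
    "R < norm x" "R < norm t" "norm x * norm t * norm t \<le> 4 * (norm x)\<^sup>2"
    by (rule ex_large_solution)
  then show ?thesis
    using LX by (intro bexI[of _ "vector [x, t, t]"]) (auto simp: S_def end_region_def all_letter)
next
  case LY
  obtain x t where "x\<^sup>2 + t\<^sup>2 + t\<^sup>2 + x * t * t = B * x + A * t + C * t + D"
    "R < norm x" "R < norm t" "norm x * norm t * norm t \<le> 4 * (norm x)\<^sup>2"
    by (rule ex_large_solution)
  then show ?thesis
    using LY by (intro bexI[of _ "vector [t, x, t]"]) (auto simp: S_def end_region_def all_letter ac_simps)
next
  case LZ
  obtain x t where "x\<^sup>2 + t\<^sup>2 + t\<^sup>2 + x * t * t = C * x + A * t + B * t + D"
    "R < norm x" "R < norm t" "norm x * norm t * norm t \<le> 4 * (norm x)\<^sup>2"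
    by (rule ex_large_solution)
  then show ?thesis
    using LZ by (intro bexI[of _ "vector [t, t, x]"]) (auto simp: S_def end_region_def all_letter ac_simps)
qed

text \<open>In two regions at once, \<open>y * z \<le> 4 * x\<close> and
  \<open>x * z \<le> 4 * y\<close> with \<open>z > 4\<close> would force both \<open>y < x\<close>
  and \<open>x < y\<close>.\<close>

lemma end_region_disjoint:
  assumes "p \<in> end_region R a" "p \<in> end_region R b" "4 \<le> R"
  shows "a = b"
proof -
  have *: False if "R < x" "R < y" "R < z" "x * y * z \<le> 4 * x\<^sup>2" "x * y * z \<le> 4 * y\<^sup>2" for x y z :: real
  proof -
    have pos: "x > 0" "y > 0" "z > 4" using that assms(3) by linarith+
    have "x * (y * z) \<le> x * (4 * x)" "y * (x * z) \<le> y * (4 * y)"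
      using that by (simp_all add: power2_eq_square mult_ac)
    then have 1: "y * z \<le> 4 * x" "x * z \<le> 4 * y" using pos by simp_all
    have "y * 4 < y * z" "x * 4 < x * z" using pos by (auto intro: mult_strict_left_mono)
    then show False using 1 by linarith
  qed
  have co: "R < norm (p$1)" "R < norm (p$2)" "R < norm (p$3)"
    using assms(1) by (auto simp: end_region_def all_letter)
  have le: "norm (p$1) * norm (p$2) * norm (p$3) \<le> 4 * (norm (coord a p))\<^sup>2"
     "norm (p$1) * norm (p$2) * norm (p$3) \<le> 4 * (norm (coord b p))\<^sup>2"
    using assms by (auto simp: end_region_def)
  have xyz: "norm (p$1) * norm (p$3) * norm (p$2) = norm (p$1) * norm (p$2) * norm (p$3)"
    "norm (p$2) * norm (p$3) * norm (p$1) = norm (p$1) * norm (p$2) * norm (p$3)"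
    by (simp_all only: mult_ac)
  define Q where "Q c \<longleftrightarrow> norm (p$1) * norm (p$2) * norm (p$3) \<le> 4 * (norm (coord c p))\<^sup>2" for c
  have "\<not> (Q LX \<and> Q LY)" "\<not> (Q LX \<and> Q LZ)" "\<not> (Q LY \<and> Q LZ)"
    using *[OF co] *[OF co(1,3,2)] *[OF co(2,3,1)] unfolding xyz Q_def coord.simps by blast+
  moreover have "Q a" "Q b" unfolding Q_def by (fact le)+
  ultimately show ?thesis by (cases a; cases b) auto
qed

text \<open>The hypotheses say that \<open>x\<close> dominates \<open>y\<close>, \<open>z\<close>
  and the homogenizing coordinate 1. The equation then makes \<open>x * (x + y * z)\<close> small
  compared with the square of \<open>norm x\<close>, so \<open>y * z\<close> is comparable to
  \<open>x\<close> and neither factor can be small.\<close>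

lemma near_vertex_estimate:
  fixes A B C D x y z :: complex
  assumes eq: "x\<^sup>2 + y\<^sup>2 + z\<^sup>2 + x * y * z = A * x + B * y + C * z + D"
    and \<delta>: "0 < \<delta>" "\<delta> \<le> 1" "2 * \<delta> * (norm A + norm B + norm C + norm D + 2) \<le> 1" "2 * \<delta> * R < 1"
    and y: "norm y \<le> \<delta> * norm x" and z: "norm z \<le> \<delta> * norm x" and x: "1 \<le> \<delta> * norm x"
  shows "R < norm x" "R < norm y" "R < norm z" "norm x * norm y * norm z \<le> 4 * (norm x)\<^sup>2"
proof -
  define n where "n = norm x"
  have n: "n > 0" using x \<delta>(1) zero_less_mult_pos[of \<delta> "norm x"] unfolding n_def by linarith
  define m where "m = \<delta> * n"
  have m: "norm y \<le> m" "norm z \<le> m" "1 \<le> m" "m \<le> n"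
    using y z x mult_right_mono[OF \<delta>(2), of n] n unfolding m_def n_def by linarith+
  have mm: "m \<le> m * m" "n \<le> m * n" "m * m \<le> m * n"
    using mult_right_mono[of 1 m m] mult_right_mono[of 1 m n] mult_left_mono[of m n m] m(3,4) n by linarith+
  have "x * (x + y * z) = A * x + B * y + C * z + D - y\<^sup>2 - z\<^sup>2"
    using eq by (simp add: algebra_simps power2_eq_square)
  then have "n * norm (x + y * z) = norm (A * x + B * y + C * z + D - y\<^sup>2 - z\<^sup>2)"
    by (metis n_def norm_mult)
  also have "\<dots> \<le> norm (A * x + B * y + C * z + D - y\<^sup>2) + norm (z\<^sup>2)" by (rule norm_triangle_ineq4)
  also have "\<dots> \<le> norm (A * x + B * y + C * z + D) + norm (y\<^sup>2) + norm (z\<^sup>2)"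
    using norm_triangle_ineq4[of "A * x + B * y + C * z + D" "y\<^sup>2"] by simp
  also have "\<dots> \<le> norm (A * x) + norm (B * y) + norm (C * z) + norm D + norm (y\<^sup>2) + norm (z\<^sup>2)"
    using norm_triangle_ineq[of "A * x + B * y + C * z" D] norm_triangle_ineq[of "A * x + B * y" "C * z"]
      norm_triangle_ineq[of "A * x" "B * y"] by linarith
  also have "\<dots> \<le> norm A * (m * n) + norm B * (m * n) + norm C * (m * n) + norm D * (m * n) + m * n + m * n"
  proof -
    have "norm (A * x) \<le> norm A * (m * n)"
      unfolding norm_mult n_def[symmetric] using mm by (intro mult_left_mono) auto
    moreover have "norm y \<le> m * n" "norm z \<le> m * n" "1 \<le> m * n" using m mm by linarith+
    then have "norm (B * y) \<le> norm B * (m * n)" "norm (C * z) \<le> norm C * (m * n)"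
      "norm D * 1 \<le> norm D * (m * n)"
      unfolding norm_mult by (auto intro!: mult_left_mono simp del: mult_1_right)
    moreover have "norm (y\<^sup>2) \<le> m * m" "norm (z\<^sup>2) \<le> m * m"
      using m by (simp_all add: norm_power power_mono flip: power2_eq_square)
    ultimately show ?thesis using mm by linarith
  qed
  also have "\<dots> = n * (n * (\<delta> * (norm A + norm B + norm C + norm D + 2)))"
    by (simp add: m_def algebra_simps)
  finally have "norm (x + y * z) \<le> n * (\<delta> * (norm A + norm B + norm C + norm D + 2))" using n by simp
  also have "\<dots> \<le> n * (1 / 2)" using \<delta>(3) n by (intro mult_left_mono) auto
  finally have h: "norm (x + y * z) \<le> n / 2" by simp
  have yz: "n / 2 \<le> norm y * norm z" "norm y * norm z \<le> 4 * n"
    using h norm_triangle_ineq2[of x "- (y * z)"] norm_triangle_ineq2[of "y * z" "- x"] n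
    by (simp_all add: n_def[symmetric] norm_mult add.commute)
  show "norm x * norm y * norm z \<le> 4 * (norm x)\<^sup>2"
    using mult_left_mono[OF yz(2), of n] n by (simp add: n_def power2_eq_square mult_ac)
  \<comment> \<open>If the product is at least \<open>n / 2\<close> and one factor is at most
    \<open>\<delta> * n\<close>, the other is at least \<open>1 / (2 * \<delta>)\<close>, which
    exceeds \<open>R\<close>.\<close>
  have low: "R < r" if "n / 2 \<le> r * s" "s \<le> \<delta> * n" "r \<ge> 0" for r s
  proof -
    have "n * (1 / 2) \<le> n * (r * \<delta>)" using that mult_left_mono[OF that(2) that(3)] by (simp add: mult_ac)
    then have "1 \<le> \<delta> * (2 * r)" using n by (simp add: mult_ac)
    then have "\<delta> * (2 * R) < \<delta> * (2 * r)" using \<delta>(4) by (simp add: mult_ac)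
    then show ?thesis using \<delta>(1) by simp
  qed
  show y': "R < norm y" using low[OF yz(1)] z by (simp add: n_def)
  show "R < norm z" using low[of "norm z" "norm y"] yz(1) y by (simp add: n_def mult.commute)
  show "R < norm x" using y' m(1,4) by (simp add: n_def)
qed

text \<open>Passes from projective convergence to the regions, for every threshold \<open>R\<close>;
  the converse direction is \<open>end_region_imp_hvert_limit\<close>.\<close>

lemma hvert_limit_imp_end_region:
  assumes lim: "(\<lambda>k. c k *s homog (u k)) \<longlonglongrightarrow> hvert j" and u: "\<And>k. u k \<in> S A B C D"
  shows "\<forall>\<^sub>F k in sequentially. u k \<in> end_region R j"
proof -
  define M where "M = norm A + norm B + norm C + norm D + 2 + \<bar>R\<bar>"
  \<comment> \<open>This gives \<open>4 * \<delta> * M = 1\<close>, so both smallness conditions of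
    \<open>near_vertex_estimate\<close> hold.\<close>
  define \<delta> where "\<delta> = 1 / (4 * M)"
  have M: "M \<ge> 2" "\<bar>R\<bar> \<le> M" "norm A + norm B + norm C + norm D + 2 \<le> M"
    unfolding M_def using norm_ge_zero[of A] norm_ge_zero[of B] norm_ge_zero[of C] norm_ge_zero[of D]
    by linarith+
  have \<delta>: "0 < \<delta>" "\<delta> \<le> 1" "4 * \<delta> * M = 1" using M by (simp_all add: \<delta>_def)
  have "2 * \<delta> * (norm A + norm B + norm C + norm D + 2) \<le> 2 * \<delta> * M"
    "2 * \<delta> * R \<le> 2 * \<delta> * M" using M \<delta> by (intro mult_left_mono; linarith)+
  then have \<delta>': "2 * \<delta> * (norm A + norm B + norm C + norm D + 2) \<le> 1" "2 * \<delta> * R < 1"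
    using \<delta>(3) by linarith+
  have small: "\<forall>\<^sub>F k in sequentially. norm ((c k *s homog (u k)) $ i - hvert j $ i) < min (1/2) (\<delta> / 2)" for i
    using tendstoD[OF tendsto_vec_nth[OF lim], of "min (1/2) (\<delta> / 2)"] \<delta>(1)
    by (simp add: dist_norm)
  have "\<forall>\<^sub>F k in sequentially. \<forall>i. norm ((c k *s homog (u k)) $ i - hvert j $ i) < min (1/2) (\<delta> / 2)"
    using small by (simp add: eventually_all_finite)
  then show ?thesis
  proof eventually_elim
    case (elim k)
    define x y z where "x = u k $ 1" and "y = u k $ 2" and "z = u k $ 3"
    have comp: "norm (c k * x - hvert j $ 1) < 1/2" "norm (c k * x - hvert j $ 1) < \<delta>/2"
      "norm (c k * y - hvert j $ 2) < 1/2" "norm (c k * y - hvert j $ 2) < \<delta>/2"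
      "norm (c k * z - hvert j $ 3) < 1/2" "norm (c k * z - hvert j $ 3) < \<delta>/2"
      "norm (c k - hvert j $ 4) < \<delta>/2"
      using elim by (simp_all add: forall_4 homog_def x_def y_def z_def)
    have eq: "x\<^sup>2 + y\<^sup>2 + z\<^sup>2 + x * y * z = A * x + B * y + C * z + D"
      using u[of k] by (simp add: S_def x_def y_def z_def)
    \<comment> \<open>Comparing two coordinates eliminates the unknown scale \<open>c k\<close>;
      taking \<open>b = 1\<close> covers the homogenizing coordinate.\<close>
    have dominated: "norm b \<le> \<delta> * norm a" if "norm (c k * a - 1) < 1/2" "norm (c k * b) < \<delta>/2" for a b
    proof -
      have "1 / 2 < norm (c k * a)"
        using that(1) norm_triangle_ineq2[of 1 "c k * a"] by (simp add: norm_minus_commute)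
      then have a: "1 / 2 < norm (c k) * norm a" by (simp add: norm_mult)
      then have "norm (c k) > 0" by (cases "c k = 0") auto
      have "norm (c k) * norm b < \<delta> * (1 / 2)" using that(2) by (simp add: norm_mult)
      also have "\<dots> < \<delta> * (norm (c k) * norm a)" using a \<delta>(1) by (rule mult_strict_left_mono)
      finally have "norm (c k) * norm b < norm (c k) * (\<delta> * norm a)" by (simp add: mult_ac)
      then show ?thesis using \<open>norm (c k) > 0\<close> by simp
    qed
    show ?case
    proof (cases j)
      case LX
      then have "norm y \<le> \<delta> * norm x" "norm z \<le> \<delta> * norm x" "1 \<le> \<delta> * norm x"
        using comp dominated[of x y] dominated[of x z] dominated[of x 1] by simp_all
      from near_vertex_estimate[OF eq \<delta>(1,2) \<delta>' this]
      show ?thesis using LX by (simp add: end_region_def all_letter x_def y_def z_def)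
    next
      case LY
      then have "norm x \<le> \<delta> * norm y" "norm z \<le> \<delta> * norm y" "1 \<le> \<delta> * norm y"
        using comp dominated[of y x] dominated[of y z] dominated[of y 1] by simp_all
      moreover have "y\<^sup>2 + x\<^sup>2 + z\<^sup>2 + y * x * z = B * y + A * x + C * z + D"
        using eq by (simp add: ac_simps)
      moreover have "2 * \<delta> * (norm B + norm A + norm C + norm D + 2) \<le> 1"
        using \<delta>'(1) by (simp add: ac_simps)
      ultimately show ?thesis
        using near_vertex_estimate[of y x z B A C D \<delta> R] \<delta> \<delta>'(2) LY
        by (simp add: end_region_def all_letter x_def y_def z_def ac_simps)
    next
      case LZ
      then have "norm x \<le> \<delta> * norm z" "norm y \<le> \<delta> * norm z" "1 \<le> \<delta> * norm z"
        using comp dominated[of z x] dominated[of z y] dominated[of z 1] by simp_all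
      moreover have "z\<^sup>2 + x\<^sup>2 + y\<^sup>2 + z * x * y = C * z + A * x + B * y + D"
        using eq by (simp add: ac_simps)
      moreover have "2 * \<delta> * (norm C + norm A + norm B + norm D + 2) \<le> 1"
        using \<delta>'(1) by (simp add: ac_simps)
      ultimately show ?thesis
        using near_vertex_estimate[of z x y C A B D \<delta> R] \<delta> \<delta>'(2) LZ
        by (simp add: end_region_def all_letter x_def y_def z_def ac_simps)
    qed
  qed
qed

lemma end_region_imp_hvert_limit:
  assumes ev: "\<And>R. \<forall>\<^sub>F k in sequentially. u k \<in> end_region R a"
  shows "(\<lambda>k. inverse (coord a (u k)) *s homog (u k)) \<longlonglongrightarrow> hvert a"
proof (rule vec_tendstoI)
  have inv0: "(\<lambda>k. inverse (coord a (u k))) \<longlonglongrightarrow> 0"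
  proof (rule tendstoI)
    fix e :: real assume e: "e > 0"
    show "\<forall>\<^sub>F k in sequentially. dist (inverse (coord a (u k))) 0 < e"
      using ev[of "inverse e"]
    proof eventually_elim
      case (elim k)
      then have "inverse e < norm (coord a (u k))" by (simp add: end_region_def)
      then show ?case using e less_imp_inverse_less[of "inverse e" "norm (coord a (u k))"]
        by (simp add: norm_inverse)
    qed
  qed
  have one: "(\<lambda>k. inverse (coord a (u k)) * coord a (u k)) \<longlonglongrightarrow> 1"
  proof (rule tendsto_eventually)
    show "\<forall>\<^sub>F k in sequentially. inverse (coord a (u k)) * coord a (u k) = 1"
      using ev[of 0] by eventually_elim (auto simp: end_region_def)
  qed
  have zero: "(\<lambda>k. inverse (coord a (u k)) * coord b (u k)) \<longlonglongrightarrow> 0" if "b \<noteq> a" for b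
  proof (rule tendstoI)
    fix e :: real assume e: "e > 0"
    show "\<forall>\<^sub>F k in sequentially. dist (inverse (coord a (u k)) * coord b (u k)) 0 < e"
      using ev[of "4 / e"]
    proof eventually_elim
      case (elim k)
      have R: "4 / e > 0" using e by simp
      have co: "4 / e < norm (u k $ 1)" "4 / e < norm (u k $ 2)" "4 / e < norm (u k $ 3)"
        using elim by (auto simp: end_region_def all_letter)
      have le: "norm (u k $ 1) * norm (u k $ 2) * norm (u k $ 3) \<le> 4 * (norm (coord a (u k)))\<^sup>2"
        using elim by (auto simp: end_region_def)
      \<comment> \<open>Again \<open>norm y * norm z \<le> 4 * norm x\<close>, now with
        \<open>norm z\<close> above \<open>4 / e\<close>.\<close>
      have *: "norm y < e * norm x" if "4 / e < norm x" "4 / e < norm y" "4 / e < norm z"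
          "norm x * norm y * norm z \<le> 4 * (norm x)\<^sup>2" for x y z :: complex
      proof -
        have pos: "norm x > 0" "norm y > 0" using that R by linarith+
        have "norm x * (norm y * norm z) \<le> norm x * (4 * norm x)"
          using that by (simp add: power2_eq_square mult_ac)
        then have "norm y * norm z \<le> 4 * norm x" using pos by simp
        moreover have "norm y * (4 / e) < norm y * norm z" using that pos by (intro mult_strict_left_mono) auto
        ultimately have "norm y * (4 / e) < 4 * norm x" by linarith
        then show ?thesis using e by (simp add: field_simps)
      qed
      have "norm (coord b (u k)) < e * norm (coord a (u k))"
        using that le co *[of "u k $ 1" "u k $ 2" "u k $ 3"] *[of "u k $ 1" "u k $ 3" "u k $ 2"]
          *[of "u k $ 2" "u k $ 1" "u k $ 3"] *[of "u k $ 2" "u k $ 3" "u k $ 1"]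
          *[of "u k $ 3" "u k $ 1" "u k $ 2"] *[of "u k $ 3" "u k $ 2" "u k $ 1"]
        by (cases a; cases b) (simp_all only: mult_ac coord.simps letter.simps simp_thms)
      moreover have "4 / e < norm (coord a (u k))" using elim by (simp add: end_region_def)
      then have "norm (coord a (u k)) > 0" using R by linarith
      ultimately show ?case by (simp add: norm_mult norm_inverse norm_divide field_simps)
    qed
  qed
  have "\<forall>i. (\<lambda>k. (inverse (coord a (u k)) *s homog (u k)) $ i) \<longlonglongrightarrow> hvert a $ i"
    using inv0 one zero[of LX] zero[of LY] zero[of LZ]
    by (cases a) (simp_all add: forall_4 homog_def)
  then show "(\<lambda>k. (inverse (coord a (u k)) *s homog (u k)) $ i) \<longlonglongrightarrow> hvert a $ i" for i by blast
qed

section \<open>Indeterminacy and attracting points of reduced words\<close>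

text \<open>Near the limit point, \<gamma> is given by continuous forms \<open>F\<close> that do not
  vanish there, so the images converge projectively to the value of \<open>F\<close>, which is the
  vertex \<open>j\<close>. Scalars are absorbed into \<open>c'\<close>.\<close>

lemma Attr_limit:
  assumes Ind: "is_Ind A B C \<gamma> (abs_cp3 (hvert i))" and Attr: "is_Attr A B C \<gamma> (abs_cp3 (hvert j))"
    and z: "\<And>k. z k \<in> S A B C D" and lim: "(\<lambda>k. c k *s homog (z k)) \<longlonglongrightarrow> v"
    and v: "v \<noteq> 0" "v $ 4 = 0" "v $ 1 * v $ 2 * v $ 3 = 0" "abs_cp3 v \<noteq> abs_cp3 (hvert i)"
  shows "\<exists>c'. (\<lambda>k. c' k *s homog (\<gamma> (z k))) \<longlonglongrightarrow> hvert j"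
proof -
  define q where "q = abs_cp3 v"
  obtain s where s: "rep_cp3 q = s *s v" "s \<noteq> 0" unfolding q_def using rep_abs_cp3[OF v(1)] .
  have "q \<in> Delta_inf" using v(2,3) by (auto simp: Delta_inf_def s(1) ac_simps)
  moreover have "q \<notin> indeterminacy A B C D \<gamma>" using Ind v(4) by (simp add: is_Ind_def q_def)
  ultimately have "extends_at A B C D \<gamma> q (abs_cp3 (hvert j))" using Attr by (simp add: is_Attr_def)
  then obtain d F where hom: "\<And>i. hom_poly d (\<lambda>v. F v $ i)"
    and agree: "\<And>p. p \<in> S A B C D \<Longrightarrow> F (homog p) \<noteq> 0 \<Longrightarrow> abs_cp3 (F (homog p)) = abs_cp3 (homog (\<gamma> p))"
    and Fq: "F (rep_cp3 q) \<noteq> 0" "abs_cp3 (hvert j) = abs_cp3 (F (rep_cp3 q))"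
    unfolding extends_at_def by blast
  have scale: "F (c *s x) = c ^ d *s F x" for c x
    using hom_poly_scale[OF hom] by (simp add: vec_eq_iff)
  have "continuous_on UNIV F"
    unfolding continuous_on_vec_nth_iff using hom_poly_continuous[OF hom] by blast
  then have "isCont F v" by (simp add: continuous_on_eq_continuous_at)
  then have Flim: "(\<lambda>k. F (c k *s homog (z k))) \<longlonglongrightarrow> F v" using lim by (rule isCont_tendsto_compose)
  have Fv: "F v \<noteq> 0" using Fq(1) unfolding s(1) scale by auto
  have "abs_cp3 (F (rep_cp3 q)) = abs_cp3 (hvert j)" using Fq(2) by simp
  then obtain t where "hvert j = t *s F (rep_cp3 q)"
    using abs_cp3_eq_iff[OF Fq(1) hvert_nonzero] by blast
  \<comment> \<open>The representative \<open>rep_cp3 q\<close> is only a multiple \<open>s\<close>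
    of \<open>v\<close>; homogeneity turns this into the factor \<open>s ^ d\<close>.\<close>
  then have vert: "hvert j = (t * s ^ d) *s F v" unfolding s(1) scale by (simp add: vector_smult_assoc)
  have "\<forall>\<^sub>F k in sequentially. F (c k *s homog (z k)) \<noteq> 0"
    using Flim Fv by (rule tendsto_imp_eventually_ne)
  then have ev: "\<forall>\<^sub>F k in sequentially. \<exists>e. F (c k *s homog (z k)) = e *s homog (\<gamma> (z k))"
  proof eventually_elim
    case (elim k)
    then have nz: "F (homog (z k)) \<noteq> 0" unfolding scale by auto
    from agree[OF z nz] have "abs_cp3 (homog (\<gamma> (z k))) = abs_cp3 (F (homog (z k)))" by simp
    then obtain e where "F (homog (z k)) = e *s homog (\<gamma> (z k))"
      using abs_cp3_eq_iff[OF homog_nonzero nz] by blast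
    then show ?case unfolding scale by (auto simp: vector_smult_assoc)
  qed
  define e where "e k = (SOME e. F (c k *s homog (z k)) = e *s homog (\<gamma> (z k)))" for k
  have "\<forall>\<^sub>F k in sequentially. F (c k *s homog (z k)) = e k *s homog (\<gamma> (z k))"
    using ev unfolding e_def by eventually_elim (rule someI_ex)
  then have elim: "(\<lambda>k. e k *s homog (\<gamma> (z k))) \<longlonglongrightarrow> F v"
    using Flim by (rule Lim_transform_eventually[rotated])
  have "(\<lambda>k. ((t * s ^ d) * e k) *s homog (\<gamma> (z k))) \<longlonglongrightarrow> hvert j"
    unfolding vert
  proof (rule vec_tendstoI)
    fix i
    have "(\<lambda>k. t * s ^ d * (e k *s homog (\<gamma> (z k))) $ i) \<longlonglongrightarrow> t * s ^ d * F v $ i"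
      by (intro tendsto_intros elim)
    then show "(\<lambda>k. ((t * s ^ d * e k) *s homog (\<gamma> (z k))) $ i) \<longlonglongrightarrow> ((t * s ^ d) *s F v) $ i"
      by (simp add: mult.assoc)
  qed
  then show ?thesis by (rule exI[where x = "\<lambda>k. t * s ^ d * e k"])
qed

lemma Attr_limit_end_region:
  assumes \<gamma>: "\<gamma> \<in> G A B C"
    and Ind: "is_Ind A B C \<gamma> (abs_cp3 (hvert i))" and Attr: "is_Attr A B C \<gamma> (abs_cp3 (hvert j))"
    and z: "\<And>k. z k \<in> S A B C D" and ev: "\<And>R. \<forall>\<^sub>F k in sequentially. z k \<in> end_region R a" and ai: "a \<noteq> i"
  shows "\<forall>\<^sub>F k in sequentially. \<gamma> (z k) \<in> end_region R j"
proof -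
  have "\<exists>c'. (\<lambda>k. c' k *s homog (\<gamma> (z k))) \<longlonglongrightarrow> hvert j"
  proof (rule Attr_limit[OF Ind Attr z end_region_imp_hvert_limit[OF ev] hvert_nonzero])
    show "hvert a $ 4 = 0" "hvert a $ 1 * hvert a $ 2 * hvert a $ 3 = 0" by (cases a; simp)+
    show "abs_cp3 (hvert a) \<noteq> abs_cp3 (hvert i)" using ai by (simp add: abs_hvert_eq_iff)
  qed
  then show ?thesis using hvert_limit_imp_end_region[OF _ G_S[OF \<gamma> z]] by (elim exE)
qed

lemma ex_S_sequence:
  obtains z where "\<And>k. z k \<in> S A B C D" "\<And>R. \<forall>\<^sub>F k in sequentially. z k \<in> end_region R a"
proof -
  define z where "z k = (SOME p. p \<in> S A B C D \<and> p \<in> end_region (real k) a)" for k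
  have z: "z k \<in> S A B C D" "z k \<in> end_region (real k) a" for k
    using someI_ex[of "\<lambda>p. p \<in> S A B C D \<and> p \<in> end_region (real k) a"] ex_S_end_region[of A B C D "real k" a]
    unfolding z_def by blast+
  have "\<forall>\<^sub>F k in sequentially. z k \<in> end_region R a" for R
    using eventually_ge_at_top[of "nat \<lceil>R\<rceil>"]
  proof eventually_elim
    case (elim k)
    then have "R \<le> real k" by linarith
    then show ?case using z(2)[of k] by (auto simp: end_region_def intro: le_less_trans)
  qed
  then show ?thesis using that z(1) by blast
qed

lemma ex_other_letter: "\<exists>c. c \<noteq> a \<and> c \<noteq> (b :: letter)"
  by (cases a; cases b) (metis letter.distinct)+

text \<open>For the rightmost letter, run the inverse word: it sends points near a vertex \<open>a \<noteq> hd w\<close> to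
  points near the vertex of \<open>last w\<close>, which \<open>\<gamma>\<close> sends back near \<open>a\<close>; since \<open>Attr \<gamma>\<close> is the vertex of
  \<open>hd w\<close>, this forces the vertex of \<open>last w\<close> to be \<open>Ind \<gamma>\<close>.\<close>

lemma Ind_Attr_letters:
  assumes w: "reduced w" and \<gamma>: "\<gamma> = word_map A B C w" "\<gamma> \<in> G A B C"
    and Ind: "is_Ind A B C \<gamma> (abs_cp3 (hvert i))" and Attr: "is_Attr A B C \<gamma> (abs_cp3 (hvert j))"
  shows "w \<noteq> []" "last w = i" "hd w = j"
proof -
  define R where "R = 16 + norm A + norm B + norm C"
  have R4: "4 \<le> R" unfolding R_def using norm_ge_zero[of A] norm_ge_zero[of B] norm_ge_zero[of C] by linarith
  show ne: "w \<noteq> []"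
  proof
    assume "w = []"
    \<comment> \<open>The identity would keep points near the vertex \<open>a\<close>, whereas
      \<open>Attr\<close> sends them to the region of \<open>j\<close>.\<close>
    obtain a where a: "a \<noteq> i" "a \<noteq> j" using ex_other_letter by blast
    obtain z where z: "\<And>k. z k \<in> S A B C 0" "\<And>R. \<forall>\<^sub>F k in sequentially. z k \<in> end_region R a"
      using ex_S_sequence[of A B C 0 a] by blast
    have "\<forall>\<^sub>F k in sequentially. z k \<in> end_region R a \<and> \<gamma> (z k) \<in> end_region R j"
      using z(2) Attr_limit_end_region[OF \<gamma>(2) Ind Attr z a(1)] by (intro eventually_conj) blast+
    then obtain k where "z k \<in> end_region R a" "\<gamma> (z k) \<in> end_region R j" by (auto simp: eventually_sequentially)
    then show False using end_region_disjoint R4 a(2) \<open>w = []\<close> \<gamma>(1) by auto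
  qed
  show hd: "hd w = j"
  proof -
    \<comment> \<open>Avoiding \<open>i\<close> makes \<open>Attr\<close> applicable, avoiding
      \<open>last w\<close> makes ping-pong applicable; both locate the same image point.\<close>
    obtain a where a: "a \<noteq> i" "a \<noteq> last w" using ex_other_letter by blast
    obtain z where z: "\<And>k. z k \<in> S A B C 0" "\<And>R. \<forall>\<^sub>F k in sequentially. z k \<in> end_region R a"
      using ex_S_sequence[of A B C 0 a] by blast
    have "\<forall>\<^sub>F k in sequentially. z k \<in> end_region R a \<and> \<gamma> (z k) \<in> end_region R j"
      using z(2) Attr_limit_end_region[OF \<gamma>(2) Ind Attr z a(1)] by (intro eventually_conj) blast+
    then obtain k where k: "z k \<in> end_region R a" "\<gamma> (z k) \<in> end_region R j" by (auto simp: eventually_sequentially)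
    have "\<gamma> (z k) \<in> end_region R (hd w)" using word_map_end_region[OF _ w ne k(1) a(2)] by (simp add: R_def \<gamma>(1))
    then show ?thesis using end_region_disjoint k(2) R4 by blast
  qed
  show "last w = i"
  proof (rule ccontr)
    assume last: "last w \<noteq> i"
    obtain a where a: "a \<noteq> hd w" using ex_other_letter by blast
    obtain z where z: "\<And>k. z k \<in> S A B C 0" "\<And>R. \<forall>\<^sub>F k in sequentially. z k \<in> end_region R a"
      using ex_S_sequence[of A B C 0 a] by blast
    define y where "y k = word_map A B C (rev w) (z k)" for k
    have \<gamma>y: "\<gamma> (y k) = z k" for k using word_map_rev[of A B C "rev w"] by (simp add: y_def \<gamma>(1))
    have "\<forall>\<^sub>F k in sequentially. y k \<in> end_region R' (last w)" for R'
      \<comment> \<open>The maximum is at least \<open>R\<close>, as ping-pong requires, and at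
        least the prescribed threshold \<open>R'\<close>.\<close>
      using z(2)[of "max R R'"]
    proof eventually_elim
      case (elim k)
      have "16 + norm A + norm B + norm C \<le> max R R'" by (simp add: R_def)
      from word_map_end_region[OF this _ _ elim, of "rev w"] w ne a
      have "y k \<in> end_region (max R R') (last w)" by (simp add: reduced_def y_def hd_rev last_rev)
      then show ?case by (auto simp: end_region_def)
    qed
    moreover have "y k \<in> S A B C 0" for k unfolding y_def by (rule word_map_S[OF z(1)])
    ultimately have "\<forall>\<^sub>F k in sequentially. \<gamma> (y k) \<in> end_region R j"
      by (intro Attr_limit_end_region[OF \<gamma>(2) Ind Attr _ _ last])
    then have "\<forall>\<^sub>F k in sequentially. z k \<in> end_region R a \<and> z k \<in> end_region R j"
      using z(2) unfolding \<gamma>y by (intro eventually_conj) blast+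
    then obtain k where "z k \<in> end_region R a" "z k \<in> end_region R j" by (auto simp: eventually_sequentially)
    then show False using end_region_disjoint R4 a hd by blast
  qed
qed

section \<open>Ping-pong types and their behaviour under commutators\<close>

definition pingpong :: "real \<Rightarrow> letter \<Rightarrow> letter \<Rightarrow> nat \<Rightarrow> (complex^3 \<Rightarrow> complex^3) \<Rightarrow> bool" where
  "pingpong R i j n f \<longleftrightarrow> (\<forall>a p. a \<noteq> i \<longrightarrow> p \<in> end_region R a \<longrightarrow>
     f p \<in> end_region R j \<and> 2 ^ n * norm (coord a p) \<le> norm (coord j (f p)))"

text \<open>The condition \<open>j \<noteq> k\<close> stands for absence of cancellation at the
  junction, and the exponents add like word lengths.\<close>

lemma pingpong_comp:
  assumes f: "pingpong R i j m f" and g: "pingpong R k l n g" and jk: "j \<noteq> k"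
  shows "pingpong R i l (m + n) (g \<circ> f)"
  unfolding pingpong_def
proof (intro allI impI)
  fix a p assume "a \<noteq> i" "p \<in> end_region R a"
  then have 1: "f p \<in> end_region R j" "2 ^ m * norm (coord a p) \<le> norm (coord j (f p))"
    using f by (auto simp: pingpong_def)
  then have 2: "g (f p) \<in> end_region R l" "2 ^ n * norm (coord j (f p)) \<le> norm (coord l (g (f p)))"
    using g jk by (auto simp: pingpong_def)
  have "2 ^ (m + n) * norm (coord a p) = 2 ^ n * (2 ^ m * norm (coord a p))" by (simp add: power_add mult_ac)
  also have "\<dots> \<le> 2 ^ n * norm (coord j (f p))" using 1(2) by (rule mult_left_mono) simp
  finally show "(g \<circ> f) p \<in> end_region R l \<and> 2 ^ (m + n) * norm (coord a p) \<le> norm (coord l ((g \<circ> f) p))"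
    using 2 by auto
qed

text \<open>Here \<open>i\<close> and \<open>j\<close> play the roles of \<open>Ind f\<close> and \<open>Attr f\<close>; the inverse exchanges them.\<close>

definition pingpong2 :: "real \<Rightarrow> letter \<Rightarrow> letter \<Rightarrow> nat \<Rightarrow> (complex^3 \<Rightarrow> complex^3) \<Rightarrow> bool" where
  "pingpong2 R i j n f \<longleftrightarrow> pingpong R i j n f \<and> pingpong R j i n (inv_into UNIV f)"

text \<open>Spell \<gamma> as a reduced word: its outer letters are \<open>j\<close> and
  \<open>i\<close>, and its inverse is spelled by the reversed word.\<close>

lemma Ind_Attr_pingpong:
  assumes R: "16 + norm A + norm B + norm C \<le> R" and \<gamma>: "\<gamma> \<in> G A B C"
    and Ind: "is_Ind A B C \<gamma> (abs_cp3 (hvert i))" and Attr: "is_Attr A B C \<gamma> (abs_cp3 (hvert j))"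
  shows "pingpong2 R i j 1 \<gamma>"
proof -
  obtain w where w: "reduced w" "\<gamma> = word_map A B C w"
    using G_imp_word_map[OF \<gamma>] ex_reduced_word by metis
  note ij = Ind_Attr_letters[OF w \<gamma> Ind Attr]
  have *: "pingpong R (last u) (hd u) 1 (word_map A B C u)" if u: "reduced u" "u \<noteq> []" for u
    unfolding pingpong_def
  proof (intro allI impI)
    fix a p assume "a \<noteq> last u" "p \<in> end_region R a"
    note h = word_map_end_region[OF R u this(2,1)]
    have "(2::real) ^ 1 \<le> 2 ^ length u" using u(2) by (intro power_increasing) (auto simp: Suc_le_eq)
    then have "2 ^ 1 * norm (coord a p) \<le> 2 ^ length u * norm (coord a p)" by (rule mult_right_mono) simp
    then show "word_map A B C u p \<in> end_region R (hd u) \<and> 2 ^ 1 * norm (coord a p) \<le> norm (coord (hd u) (word_map A B C u p))"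
      using h by linarith
  qed
  show ?thesis
    unfolding pingpong2_def w(2) inv_word_map using *[of w] *[of "rev w"] w(1) ij
    by (simp add: reduced_def hd_rev last_rev)
qed

text \<open>From right to left the four factors have types \<open>(l, k)\<close>,
  \<open>(j, i)\<close>, \<open>(k, l)\<close>, \<open>(i, j)\<close>, and the hypotheses
  \<open>ne\<close> are the three junction conditions. The inverse commutator meets the same
  three.\<close>

lemma pingpong2_commutator:
  assumes bij: "bij f" "bij g" and f: "pingpong2 R i j n f" and g: "pingpong2 R k l n g"
    and ne: "k \<noteq> j" "i \<noteq> k" "l \<noteq> i"
  shows "pingpong2 R l j (4 * n) (commutator f g)"
proof -
  have inv: "inv_into UNIV (commutator f g) = g \<circ> f \<circ> (inv_into UNIV g \<circ> inv_into UNIV f)"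
    unfolding commutator_def using bij
    by (simp add: o_inv_distrib bij_comp bij_imp_bij_inv inv_inv_eq)
  note fg = f[unfolded pingpong2_def] g[unfolded pingpong2_def]
  have "pingpong R l j ((n + n) + (n + n)) (f \<circ> g \<circ> (inv_into UNIV f \<circ> inv_into UNIV g))"
    using fg ne by (blast intro: pingpong_comp)
  moreover have "pingpong R j l ((n + n) + (n + n)) (g \<circ> f \<circ> (inv_into UNIV g \<circ> inv_into UNIV f))"
    using fg ne by (blast intro: pingpong_comp)
  moreover have "(n + n) + (n + n) = 4 * n" by simp
  ultimately show ?thesis unfolding pingpong2_def inv unfolding commutator_def by (simp only: simp_thms)
qed

section \<open>Iterated commutators and Fatou components\<close>

text \<open>The supremum bounds the displacement because the latter is bounded above, by compactness
  of the closed ball.\<close>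

lemma displacement_SUP:
  assumes \<gamma>: "\<gamma> \<in> G A B C" and sup: "(SUP z\<in>ball p \<epsilon>. norm (\<gamma> z - z)) < K" and z: "z \<in> ball p \<epsilon>"
  shows "norm (\<gamma> z - z) < K"
proof -
  have "compact ((\<lambda>z. norm (\<gamma> z - z)) ` cball p \<epsilon>)"
    by (intro compact_continuous_image continuous_intros G_continuous[OF \<gamma>] compact_cball)
  then have "bdd_above ((\<lambda>z. norm (\<gamma> z - z)) ` cball p \<epsilon>)"
    by (intro bounded_imp_bdd_above compact_imp_bounded)
  then have "bdd_above ((\<lambda>z. norm (\<gamma> z - z)) ` ball p \<epsilon>)"
    by (rule bdd_above_mono) auto
  then have "norm (\<gamma> z - z) \<le> (SUP z\<in>ball p \<epsilon>. norm (\<gamma> z - z))" using z by (rule cSUP_upper[rotated])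
  then show ?thesis using sup by simp
qed

text \<open>The radii decrease from \<open>\<epsilon>\<close> to \<open>3\<epsilon>/4\<close>, with steps of the same order \<open>\<epsilon> / 2\<^sup>m\<close> as the
  displacement, which leaves room for the loss of domain in each commutator.\<close>

definition near_id :: "complex^3 \<Rightarrow> real \<Rightarrow> nat \<Rightarrow> (complex^3 \<Rightarrow> complex^3) \<Rightarrow> bool" where
  "near_id p \<epsilon> m f \<longleftrightarrow>
     (\<forall>z\<in>ball p (\<epsilon> * (3/4 + 1 / (4 * 2^m))). norm (f z - z) < \<epsilon> / (1000 * 2^m))"

lemma near_id_commutator:
  assumes \<epsilon>: "\<epsilon> > 0" and fg: "f \<in> G A B C" "g \<in> G A B C"
    and near: "near_id p \<epsilon> m f" "near_id p \<epsilon> m g"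
  shows "near_id p \<epsilon> (Suc m) (commutator f g)"
  unfolding near_id_def
proof
  define e where "e = \<epsilon> / 2^m"
  have e: "e > 0" using \<epsilon> by (simp add: e_def)
  \<comment> \<open>The radius drops by \<open>e / 8\<close>, so \<open>\<rho> = e / 16\<close> and
    \<open>\<delta> = e / 1000\<close> in \<open>commutator_displacement\<close>; the new bound
    \<open>208 * e / 10^6\<close> is below \<open>e / 2000\<close>.\<close>
  have eqs: "\<epsilon> * (3/4 + 1 / (4 * 2^Suc m)) = \<epsilon> * (3/4 + 1 / (4 * 2^m)) - 2 * (e / 16)"
    "\<epsilon> / (1000 * 2^m) = e / 1000" "\<epsilon> / (1000 * 2^Suc m) = e / 2000"
    by (simp_all add: e_def field_simps)
  fix z assume z: "z \<in> ball p (\<epsilon> * (3/4 + 1 / (4 * 2^Suc m)))"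
  have "norm (commutator f g z - z) < 13 * (e / 1000)\<^sup>2 / (e / 16)"
    by (rule commutator_displacement[OF fg, where r = "\<epsilon> * (3/4 + 1 / (4 * 2^m))"])
      (use near z e in \<open>simp_all add: near_id_def eqs(1,2) del: mem_ball power_Suc\<close>)
  also have "\<dots> \<le> e / 2000" using e by (simp add: power2_eq_square field_simps)
  finally show "norm (commutator f g z - z) < \<epsilon> / (1000 * 2^Suc m)" unfolding eqs(3) .
qed

text \<open>Commutators of elements of types \<open>(i, j)\<close> and \<open>(k, j)\<close> have type \<open>(j, j)\<close>, and those of types
  \<open>(j, j)\<close> and \<open>(i, i)\<close> have type \<open>(i, j)\<close>, so all types are recovered after two steps.\<close>

lemma ex_iterated_commutators:
  assumes \<epsilon>: "\<epsilon> > 0"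
    and base: "\<And>i j. i \<noteq> j \<Longrightarrow> \<exists>\<gamma>\<in>G A B C. pingpong2 R i j 1 \<gamma> \<and> near_id p \<epsilon> 0 \<gamma>"
    and ij: "i \<noteq> j"
  shows "\<exists>\<gamma>\<in>G A B C. pingpong2 R i j (16 ^ m) \<gamma> \<and> near_id p \<epsilon> (2 * m) \<gamma>"
  using ij
proof (induction m arbitrary: i j)
  case 0
  then show ?case using base by simp
next
  case (Suc m)
  have diag: "\<exists>c\<in>G A B C. pingpong2 R j j (4 * 16 ^ m) c \<and> near_id p \<epsilon> (Suc (2 * m)) c" for j
  proof -
    obtain i where i: "i \<noteq> j" using ex_other_letter by blast
    obtain k where k: "k \<noteq> i" "k \<noteq> j" using ex_other_letter by blast
    obtain f where f: "f \<in> G A B C" "pingpong2 R i j (16 ^ m) f" "near_id p \<epsilon> (2 * m) f"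
      using Suc.IH[OF i] by blast
    obtain g where g: "g \<in> G A B C" "pingpong2 R k j (16 ^ m) g" "near_id p \<epsilon> (2 * m) g"
      using Suc.IH[OF k(2)] by blast
    have "pingpong2 R j j (4 * 16 ^ m) (commutator f g)"
      using i k by (intro pingpong2_commutator[OF G_imp_bij[OF f(1)] G_imp_bij[OF g(1)] f(2) g(2)]) auto
    then show ?thesis
      using near_id_commutator[OF \<epsilon> f(1) g(1) f(3) g(3)] G_commutator[OF f(1) g(1)] by blast
  qed
  obtain f where f: "f \<in> G A B C" "pingpong2 R j j (4 * 16 ^ m) f" "near_id p \<epsilon> (Suc (2 * m)) f"
    using diag by blast
  obtain g where g: "g \<in> G A B C" "pingpong2 R i i (4 * 16 ^ m) g" "near_id p \<epsilon> (Suc (2 * m)) g"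
    using diag by blast
  \<comment> \<open>Two commutators per round: the exponent is multiplied by 4 twice.\<close>
  have "pingpong2 R i j (4 * (4 * 16 ^ m)) (commutator f g)"
    using Suc.prems by (intro pingpong2_commutator[OF G_imp_bij[OF f(1)] G_imp_bij[OF g(1)] f(2) g(2)]) auto
  moreover have "near_id p \<epsilon> (2 * Suc m) (commutator f g)"
    using near_id_commutator[OF \<epsilon> f(1) g(1) f(3) g(3)] by simp
  ultimately show ?case using G_commutator[OF f(1) g(1)] by (intro bexI[of _ "commutator f g"]) auto
qed

section \<open>Escape to infinity in Fatou components\<close>

lemma closed_S: "closed (S A B C D)"
  unfolding S_def by (intro closed_Collect_eq continuous_intros)

text \<open>Otherwise some subsequence stays bounded at \<open>b\<close>. By normality a further one
  converges locally uniformly, contradicting escape at \<open>a\<close>, or tends to infinity,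
  contradicting boundedness at \<open>b\<close>.\<close>

lemma normal_on_escape:
  assumes norm: "normal_on (S A B C D) (G_on A B C D) U" and ab: "a \<in> U" "b \<in> U" and U: "U \<subseteq> S A B C D"
    and f: "\<And>n. f n \<in> G A B C" and a: "filterlim (\<lambda>n. norm (f n a)) at_top sequentially"
  shows "filterlim (\<lambda>n. norm (f n b)) at_top sequentially"
proof (rule ccontr)
  assume "\<not> ?thesis"
  then obtain Z where "\<not> (\<forall>\<^sub>F n in sequentially. Z \<le> norm (f n b))"
    by (auto simp: filterlim_at_top)
  then have "infinite {n. \<not> Z \<le> norm (f n b)}"
    by (simp add: eventually_cofinite flip: cofinite_eq_sequentially)
  then obtain s :: "nat \<Rightarrow> nat" where s: "strict_mono s" "\<And>n. s n \<in> {n. \<not> Z \<le> norm (f n b)}"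
    using infinite_enumerate by blast
  define g where "g n = restrict (f (s n)) (S A B C D)" for n
  have "\<forall>n. g n \<in> G_on A B C D" using f by (auto simp: g_def G_on_def)
  then obtain r where r: "strict_mono r"
    "conv_locally_uniformly U (g \<circ> r) \<or> conv_to_infinity (S A B C D) U (g \<circ> r)"
    using norm unfolding normal_on_def by blast
  show False
    using r(2)
  proof
    assume "conv_locally_uniformly U (g \<circ> r)"
    then obtain h where "uniform_limit {a} (g \<circ> r) h sequentially"
      using ab(1) compact_sing[of a] unfolding conv_locally_uniformly_def by blast
    then have "(\<lambda>n. (g \<circ> r) n a) \<longlonglongrightarrow> h a" by (rule tendsto_uniform_limitI) simp
    then have "(\<lambda>n. norm (f (s (r n)) a)) \<longlonglongrightarrow> norm (h a)"
      using ab(1) U by (intro tendsto_norm) (auto simp: g_def)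
    moreover have "filterlim (\<lambda>n. norm (f ((s \<circ> r) n) a)) at_top sequentially"
      using filterlim_compose[OF a filterlim_subseq[OF strict_mono_o[OF s(1) r(1)]]] .
    then have "filterlim (\<lambda>n. norm (f (s (r n)) a)) at_infinity sequentially"
      unfolding o_apply by (rule filterlim_at_top_imp_at_infinity)
    ultimately show False by (rule not_tendsto_and_filterlim_at_infinity[OF sequentially_bot])
  next
    assume inf: "conv_to_infinity (S A B C D) U (g \<circ> r)"
    have "compact (cball 0 Z \<inter> S A B C D)" by (intro compact_Int_closed compact_cball closed_S)
    then have "finite {n. (g \<circ> r) n ` {b} \<inter> (cball 0 Z \<inter> S A B C D) \<noteq> {}}"
      using ab(2) by (intro inf[unfolded conv_to_infinity_def, rule_format] conjI) auto
    moreover have "(g \<circ> r) n b \<in> cball 0 Z \<inter> S A B C D" for n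
      using s(2)[of "r n"] ab(2) U G_S[OF f] by (auto simp: g_def)
    then have "{n. (g \<circ> r) n ` {b} \<inter> (cball 0 Z \<inter> S A B C D) \<noteq> {}} = UNIV" by auto
    ultimately show False by simp
  qed
qed

text \<open>By \<open>normal_on_escape\<close> in both directions, escape is a locally constant
  property on the connected set \<Omega>.\<close>

lemma fatou_component_escape:
  assumes \<Omega>: "fatou_component A B C D \<Omega>" and ab: "a \<in> \<Omega>" "b \<in> \<Omega>"
    and f: "\<And>n. f n \<in> G A B C" and a: "filterlim (\<lambda>n. norm (f n a)) at_top sequentially"
  shows "filterlim (\<lambda>n. norm (f n b)) at_top sequentially"
proof -
  define T where "T q \<longleftrightarrow> filterlim (\<lambda>n. norm (f n q)) at_top sequentially" for q
  have comp: "\<Omega> \<in> components (fatou_set A B C D)" using \<Omega> by (simp add: fatou_component_def)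
  have sub: "\<Omega> \<subseteq> fatou_set A B C D" "fatou_set A B C D \<subseteq> S A B C D"
    using in_components_subset[OF comp] by (auto simp: fatou_set_def)
  have "T a = T b"
  proof (rule connected_local_const[OF in_components_connected[OF comp] ab], rule ballI)
    fix q assume q: "q \<in> \<Omega>"
    then obtain U where U: "openin (top_of_set (S A B C D)) U" "q \<in> U"
      "normal_on (S A B C D) (G_on A B C D) U" using sub(1) by (auto simp: fatou_set_def)
    then obtain V where V: "open V" "U = S A B C D \<inter> V" by (auto simp: openin_open)
    have "T q = T x" if "x \<in> V" "x \<in> \<Omega>" for x
    proof -
      have "x \<in> U" "U \<subseteq> S A B C D" using that sub V by auto
      then show ?thesis
        unfolding T_def using U(2)
        by (intro iffI; elim normal_on_escape[where f = f, OF U(3) _ _ _ f, rotated -1])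
    qed
    then show "\<forall>\<^sub>F x in at q within \<Omega>. T q = T x"
      unfolding eventually_at_topological using V U(2) by blast
  qed
  then show ?thesis using a by (simp add: T_def)
qed

section \<open>Limit points of the surface at infinity\<close>

lemma norm_le_norm_homog: "norm p \<le> 3 * norm (homog p)"
proof (rule norm_vec_le_bound)
  have "norm (p $ 1) \<le> norm (homog p)" "norm (p $ 2) \<le> norm (homog p)" "norm (p $ 3) \<le> norm (homog p)"
    using Finite_Cartesian_Product.norm_nth_le[of "homog p" 1]
      Finite_Cartesian_Product.norm_nth_le[of "homog p" 2]
      Finite_Cartesian_Product.norm_nth_le[of "homog p" 3] by (simp_all add: homog_def)
  then show "norm (p $ i) \<le> norm (homog p)" for i by (metis exhaust_3)
qed

text \<open>Normalize homogeneous coordinates to the unit sphere and use compactness. The last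
  coordinate tends to 0, and the surface equation bounds the cubic term by a quadratic one, so the
  limit lies on the triangle.\<close>

lemma limit_at_infinity:
  assumes z: "\<And>k. z k \<in> S A B C D" and inf: "\<And>k. real k \<le> norm (z k)"
  obtains s c v where "strict_mono s" "(\<lambda>k. c k *s homog (z (s k))) \<longlonglongrightarrow> v" "v \<noteq> 0"
    "v $ 4 = 0" "v $ 1 * v $ 2 * v $ 3 = 0"
proof -
  define N where "N k = norm (homog (z k))" for k
  define u where "u k = complex_of_real (1 / N k) *s homog (z k)" for k
  have N1: "1 \<le> N k" for k
    using Finite_Cartesian_Product.norm_nth_le[of "homog (z k)" 4] by (simp add: N_def homog_def)
  have Npos: "0 < N k" for k using N1[of k] by linarith
  have "filterlim (\<lambda>k. 3 * N k) at_top sequentially"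
  proof (rule filterlim_at_top_mono[OF filterlim_real_sequentially], rule always_eventually, rule allI)
    fix k show "real k \<le> 3 * N k"
      using norm_le_norm_homog[of "z k"] inf[of k] unfolding N_def by linarith
  qed
  then have "(\<lambda>k. 3 / (3 * N k)) \<longlonglongrightarrow> 0"
    by (intro tendsto_divide_0[OF tendsto_const] filterlim_at_top_imp_at_infinity)
  then have invN: "(\<lambda>k. 1 / N k) \<longlonglongrightarrow> 0" by simp
  have u1: "u k \<in> sphere 0 1" for k
    using Npos[of k] by (simp add: u_def norm_vec_smult N_def norm_divide)
  have "compact (sphere (0::complex^4) 1)" by simp
  then obtain v s where v: "v \<in> sphere 0 1" and s: "strict_mono s" and lim: "(u \<circ> s) \<longlonglongrightarrow> v"
    using u1 unfolding compact_def by blast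
  have invNs: "(\<lambda>k. 1 / N (s k)) \<longlonglongrightarrow> 0"
    using LIMSEQ_subseq_LIMSEQ[OF invN s] by (simp add: o_def)
  have comp: "(\<lambda>k. u (s k) $ i) \<longlonglongrightarrow> v $ i" for i
    using tendsto_vec_nth[OF lim] by (simp add: o_def)
  have "(\<lambda>k. u (s k) $ 4) \<longlonglongrightarrow> 0"
    using tendsto_of_real[OF invNs, where 'a = complex] by (simp add: u_def homog_def)
  then have v4: "v $ 4 = 0" using comp LIMSEQ_unique by blast
  define M where "M = norm A + norm B + norm C + norm D + 3"
  have bound: "norm (u k $ 1 * u k $ 2 * u k $ 3) \<le> M * (1 / N k)" for k
  proof -
    define x y w where "x = z k $ 1" and "y = z k $ 2" and "w = z k $ 3"
    have le: "norm x \<le> N k" "norm y \<le> N k" "norm w \<le> N k"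
      using Finite_Cartesian_Product.norm_nth_le[of "homog (z k)" 1]
        Finite_Cartesian_Product.norm_nth_le[of "homog (z k)" 2]
        Finite_Cartesian_Product.norm_nth_le[of "homog (z k)" 3]
      by (simp_all add: homog_def N_def x_def y_def w_def)
    have NN: "N k \<le> (N k)\<^sup>2" using mult_right_mono[OF N1[of k], of "N k"] Npos[of k] by (simp add: power2_eq_square)
    have "x * y * w = A * x + B * y + C * w + D - x\<^sup>2 - y\<^sup>2 - w\<^sup>2"
      using z[of k] by (simp add: S_def x_def y_def w_def algebra_simps)
    then have "norm (x * y * w) = norm (A * x + B * y + C * w + D - x\<^sup>2 - y\<^sup>2 - w\<^sup>2)" by simp
    then have "norm (x * y * w) \<le> norm (A * x) + norm (B * y) + norm (C * w) + norm D
        + norm (x\<^sup>2) + norm (y\<^sup>2) + norm (w\<^sup>2)"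
      using norm_triangle_ineq4[of "A * x + B * y + C * w + D - x\<^sup>2 - y\<^sup>2" "w\<^sup>2"]
        norm_triangle_ineq4[of "A * x + B * y + C * w + D - x\<^sup>2" "y\<^sup>2"]
        norm_triangle_ineq4[of "A * x + B * y + C * w + D" "x\<^sup>2"]
        norm_triangle_ineq[of "A * x + B * y + C * w" D] norm_triangle_ineq[of "A * x + B * y" "C * w"]
        norm_triangle_ineq[of "A * x" "B * y"] by linarith
    also have "\<dots> \<le> norm A * (N k)\<^sup>2 + norm B * (N k)\<^sup>2 + norm C * (N k)\<^sup>2 + norm D * (N k)\<^sup>2
        + (N k)\<^sup>2 + (N k)\<^sup>2 + (N k)\<^sup>2"
    proof -
      have lin: "norm (c * t) \<le> norm c * (N k)\<^sup>2" if "norm t \<le> N k" for c t :: complex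
        unfolding norm_mult using that NN by (intro mult_left_mono norm_ge_zero) linarith
      have sq: "norm (t\<^sup>2) \<le> (N k)\<^sup>2" if "norm t \<le> N k" for t :: complex
        using that by (simp add: norm_power power_mono)
      have "norm (D * 1) \<le> norm D * (N k)\<^sup>2" using N1[of k] by (intro lin) simp
      then show ?thesis
        using lin[OF le(1), of A] lin[OF le(2), of B] lin[OF le(3), of C] sq[OF le(1)] sq[OF le(2)] sq[OF le(3)]
        unfolding mult_1_right by linarith
    qed
    also have "\<dots> = M * (N k)\<^sup>2" by (simp add: M_def algebra_simps)
    finally have "norm (x * y * w) \<le> M * (N k)\<^sup>2" .
    \<comment> \<open>Normalizing three coordinates divides the product by the cube of
      \<open>N k\<close>, which leaves \<open>M / N k\<close>.\<close>
    then have "norm (x * y * w) / (N k)^3 \<le> M * (N k)\<^sup>2 / (N k)^3"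
      using Npos[of k] by (intro divide_right_mono) auto
    also have "\<dots> = M * (1 / N k)" using Npos[of k] by (simp add: power2_eq_square power3_eq_cube)
    finally show ?thesis
      using Npos[of k] by (simp add: u_def homog_def norm_mult norm_divide x_def y_def w_def power3_eq_cube mult_ac)
  qed
  have "(\<lambda>k. u (s k) $ 1 * u (s k) $ 2 * u (s k) $ 3) \<longlonglongrightarrow> 0"
  proof (rule Lim_null_comparison)
    show "\<forall>\<^sub>F k in sequentially. norm (u (s k) $ 1 * u (s k) $ 2 * u (s k) $ 3) \<le> M * (1 / N (s k))"
      by (rule always_eventually) (use bound in blast)
    show "(\<lambda>k. M * (1 / N (s k))) \<longlonglongrightarrow> 0" using tendsto_mult_right_zero[OF invNs] .
  qed
  moreover have "(\<lambda>k. u (s k) $ 1 * u (s k) $ 2 * u (s k) $ 3) \<longlonglongrightarrow> v $ 1 * v $ 2 * v $ 3"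
    by (intro tendsto_mult comp)
  ultimately have v123: "v $ 1 * v $ 2 * v $ 3 = 0" using LIMSEQ_unique by blast
  show ?thesis
    by (rule that[OF s _ _ v4 v123, where c = "\<lambda>k. complex_of_real (1 / N (s k))"])
      (use lim v in \<open>auto simp: u_def o_def\<close>)
qed

lemma coord_le_norm: "norm (coord a p) \<le> norm p"
  by (cases a) (auto simp: Finite_Cartesian_Product.norm_nth_le)

theorem theoremH:
  shows "\<forall>\<epsilon>::real. \<epsilon> > 0 \<longrightarrow> (\<exists>K::real. K > 0 \<and>
    (\<forall>(A::complex) (B::complex) (C::complex) (p::complex^3).
      (\<forall>v\<in>V_inf. \<forall>w\<in>V_inf. v \<noteq> w \<longrightarrow>
         (\<exists>\<gamma>. hyperbolic A B C \<gamma> \<and> is_Ind A B C \<gamma> v \<and> is_Attr A B C \<gamma> w \<and>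
              (SUP z\<in>ball p \<epsilon>. norm (\<gamma> z - z)) < K))
      \<longrightarrow> (\<forall>(D::complex) \<Omega>. fatou_component A B C D \<Omega> \<and> \<not> bounded \<Omega>
             \<longrightarrow> (ball p (\<epsilon> / 2) \<inter> S A B C D) \<inter> \<Omega> = {})))"
proof (intro allI impI)
  fix \<epsilon> :: real assume \<epsilon>: "\<epsilon> > 0"
  show "\<exists>K::real. K > 0 \<and>
    (\<forall>(A::complex) (B::complex) (C::complex) (p::complex^3).
      (\<forall>v\<in>V_inf. \<forall>w\<in>V_inf. v \<noteq> w \<longrightarrow>
         (\<exists>\<gamma>. hyperbolic A B C \<gamma> \<and> is_Ind A B C \<gamma> v \<and> is_Attr A B C \<gamma> w \<and>
              (SUP z\<in>ball p \<epsilon>. norm (\<gamma> z - z)) < K))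
      \<longrightarrow> (\<forall>(D::complex) \<Omega>. fatou_component A B C D \<Omega> \<and> \<not> bounded \<Omega>
             \<longrightarrow> (ball p (\<epsilon> / 2) \<inter> S A B C D) \<inter> \<Omega> = {}))"
  \<comment> \<open>The constant is the displacement bound of \<open>near_id\<close> at level 0,
    where the radius is \<epsilon>.\<close>
  proof (intro exI[of _ "\<epsilon> / 1000"] conjI allI impI)
    fix A B C D :: complex and p :: "complex^3" and \<Omega>
    assume hyp: "\<forall>v\<in>V_inf. \<forall>w\<in>V_inf. v \<noteq> w \<longrightarrow>
         (\<exists>\<gamma>. hyperbolic A B C \<gamma> \<and> is_Ind A B C \<gamma> v \<and> is_Attr A B C \<gamma> w \<and>
              (SUP z\<in>ball p \<epsilon>. norm (\<gamma> z - z)) < \<epsilon> / 1000)"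
      and \<Omega>: "fatou_component A B C D \<Omega> \<and> \<not> bounded \<Omega>"
    define R where "R = 16 + norm A + norm B + norm C"
    have R: "1 \<le> R" unfolding R_def using norm_ge_zero[of A] norm_ge_zero[of B] norm_ge_zero[of C] by linarith
    have gen: "\<exists>\<gamma>\<in>G A B C. is_Ind A B C \<gamma> (abs_cp3 (hvert i)) \<and> is_Attr A B C \<gamma> (abs_cp3 (hvert j)) \<and>
        pingpong2 R i j 1 \<gamma> \<and> near_id p \<epsilon> 0 \<gamma>" if "i \<noteq> j" for i j
    proof -
      have "abs_cp3 (hvert i) \<noteq> abs_cp3 (hvert j)" using that by (simp add: abs_hvert_eq_iff)
      then obtain \<gamma> where \<gamma>: "hyperbolic A B C \<gamma>" "is_Ind A B C \<gamma> (abs_cp3 (hvert i))"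
          "is_Attr A B C \<gamma> (abs_cp3 (hvert j))" "(SUP z\<in>ball p \<epsilon>. norm (\<gamma> z - z)) < \<epsilon> / 1000"
        using hyp unfolding V_inf_eq by blast
      have G: "\<gamma> \<in> G A B C" using \<gamma>(1) by (simp add: hyperbolic_def)
      have "near_id p \<epsilon> 0 \<gamma>" using displacement_SUP[OF G \<gamma>(4)] by (simp add: near_id_def)
      moreover have "pingpong2 R i j 1 \<gamma>"
        using Ind_Attr_pingpong[OF _ G \<gamma>(2,3)] by (simp add: R_def)
      ultimately show ?thesis using G \<gamma>(2,3) by blast
    qed
    show "(ball p (\<epsilon> / 2) \<inter> S A B C D) \<inter> \<Omega> = {}"
    proof (rule ccontr)
      assume "(ball p (\<epsilon> / 2) \<inter> S A B C D) \<inter> \<Omega> \<noteq> {}"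
      then obtain q where q: "q \<in> ball p (\<epsilon> / 2)" "q \<in> \<Omega>" by blast
      have \<Omega>S: "\<Omega> \<subseteq> S A B C D"
        using \<Omega> in_components_subset unfolding fatou_component_def fatou_set_def by blast
      have "\<exists>x\<in>\<Omega>. real k \<le> norm x" for k using \<Omega> unfolding bounded_iff by (meson linear)
      then obtain z where z: "\<And>k. z k \<in> \<Omega>" "\<And>k. real k \<le> norm (z k)" by metis
      then have zS: "z k \<in> S A B C D" for k using \<Omega>S by blast
      obtain s c v where s: "strict_mono s" and lim: "(\<lambda>k. c k *s homog (z (s k))) \<longlonglongrightarrow> v"
        and v: "v \<noteq> 0" "v $ 4 = 0" "v $ 1 * v $ 2 * v $ 3 = 0"
        using limit_at_infinity[of z A B C D] zS z(2) by blast
      \<comment> \<open>The limit point is at most one vertex, so some vertex can serve as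
        \<open>Ind\<close> of \<gamma> without interfering.\<close>
      have "\<exists>i. abs_cp3 v \<noteq> abs_cp3 (hvert i)" using abs_hvert_eq_iff[of LX LY] by (metis letter.distinct(1))
      then obtain i where i: "abs_cp3 v \<noteq> abs_cp3 (hvert i)" by blast
      obtain j where j: "j \<noteq> i" using ex_other_letter by blast
      \<comment> \<open>The iterated commutators get type \<open>(l, j)\<close>: as
        \<open>l \<noteq> j\<close>, they expand on the region of \<open>j\<close>, where \<gamma>
        has put the point.\<close>
      obtain l where l: "l \<noteq> j" using ex_other_letter by blast
      obtain \<gamma> where \<gamma>: "\<gamma> \<in> G A B C" "is_Ind A B C \<gamma> (abs_cp3 (hvert i))"
          "is_Attr A B C \<gamma> (abs_cp3 (hvert j))" "near_id p \<epsilon> 0 \<gamma>"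
        using gen[OF j[symmetric]] by blast
      obtain c' where "(\<lambda>k. c' k *s homog (\<gamma> (z (s k)))) \<longlonglongrightarrow> hvert j"
        using Attr_limit[OF \<gamma>(2,3) zS lim v i] by blast
      from hvert_limit_imp_end_region[OF this G_S[OF \<gamma>(1) zS]]
      have "\<forall>\<^sub>F k in sequentially. \<gamma> (z (s k)) \<in> end_region R j" .
      then obtain k where k: "\<gamma> (z (s k)) \<in> end_region R j" by (auto simp: eventually_sequentially)
      have "\<exists>g\<in>G A B C. pingpong2 R l j (16 ^ m) g \<and> near_id p \<epsilon> (2 * m) g" for m
        using gen l by (intro ex_iterated_commutators[OF \<epsilon>]) blast+
      then obtain g where g: "\<And>m. g m \<in> G A B C" "\<And>m. pingpong2 R l j (16 ^ m) (g m)"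
        "\<And>m. near_id p \<epsilon> (2 * m) (g m)" by metis
      define f where "f m = g m \<circ> \<gamma>" for m
      have f: "f m \<in> G A B C" for m unfolding f_def by (rule G_comp[OF g(1) \<gamma>(1)])
      have "filterlim (\<lambda>m. norm (f m (z (s k)))) at_top sequentially"
      proof (rule filterlim_at_top_mono[OF filterlim_real_sequentially], rule always_eventually, rule allI)
        fix m
        \<comment> \<open>The expansion factor is \<open>2 ^ (16 ^ m)\<close>, applied to a
          coordinate of norm above \<open>R \<ge> 1\<close>.\<close>
        have "real m \<le> 2 ^ m" by (rule less_imp_le[OF of_nat_less_two_power])
        also have "\<dots> \<le> 2 ^ (16 ^ m)"
          by (intro power_increasing less_imp_le[OF power_gt_expt]) auto
        also have "\<dots> \<le> 2 ^ (16 ^ m) * norm (coord j (\<gamma> (z (s k))))"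
          using k R by (auto simp: end_region_def intro: order_trans less_imp_le)
        also have "\<dots> \<le> norm (coord j (g m (\<gamma> (z (s k)))))"
          using g(2)[of m] k l by (auto simp: pingpong2_def pingpong_def)
        also have "\<dots> \<le> norm (f m (z (s k)))" unfolding f_def o_apply by (rule coord_le_norm)
        finally show "real m \<le> norm (f m (z (s k)))" .
      qed
      from fatou_component_escape[OF conjunct1[OF \<Omega>] z(1) q(2) f this]
      have esc: "filterlim (\<lambda>m. norm (f m q)) at_top sequentially" .
      \<comment> \<open>First \<gamma> moves \<open>q\<close> from the half ball into the ball of
        radius \<open>3/4 * \<epsilon>\<close>, which lies in the domain of every
        \<open>near_id\<close> estimate; then \<open>g m\<close> moves it by less than
        \<epsilon>.\<close>
      have bounded: "norm (f m q) \<le> norm p + 2 * \<epsilon>" for m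
      proof -
        have "q \<in> ball p (\<epsilon> * (3/4 + 1 / (4 * 2^0)))" using q(1) \<epsilon> by simp
        then have 1: "norm (\<gamma> q - q) < \<epsilon> / 1000" using \<gamma>(4) by (force simp: near_id_def)
        then have "dist p (\<gamma> q) < \<epsilon> * (3/4)"
          using q(1) \<epsilon> dist_triangle[of p "\<gamma> q" q] by (simp add: dist_norm norm_minus_commute)
        also have "\<dots> \<le> \<epsilon> * (3/4 + 1 / (4 * 2^(2*m)))" using \<epsilon> by (intro mult_left_mono) auto
        finally have "\<gamma> q \<in> ball p (\<epsilon> * (3/4 + 1 / (4 * 2^(2*m))))" by simp
        then have "norm (f m q - \<gamma> q) < \<epsilon> / (1000 * 2 ^ (2 * m))" 
          using g(3)[of m] by (simp add: near_id_def f_def del: mem_ball)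
        also have "\<dots> \<le> \<epsilon> / 1" using \<epsilon> by (intro divide_left_mono) (auto intro: order_trans[of 1 "1000::real"])
        finally have "norm (f m q - \<gamma> q) < \<epsilon>" by simp
        moreover have "norm (\<gamma> q - p) < \<epsilon> * (3/4)"
          using \<open>dist p (\<gamma> q) < \<epsilon> * (3/4)\<close> by (simp add: dist_norm norm_minus_commute)
        ultimately show ?thesis
          using norm_triangle_ineq[of "f m q - \<gamma> q" "\<gamma> q"] norm_triangle_ineq[of "\<gamma> q - p" p] \<epsilon> by simp
      qed
      obtain m where "norm p + 2 * \<epsilon> + 1 \<le> norm (f m q)"
        using esc unfolding filterlim_at_top eventually_sequentially by blast
      then show False using bounded[of m] by linarith
    qed
  qed (use \<epsilon> in simp)
qed

end
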